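(* Let $\Omega$ be a bounded domain in $\mathbb{C}^n$ and let $\mathcal{R}$ be a finite rank quasi-free Hilbert module over $A=A(\Omega)$, of rank $m$. Then the restriction to $\mathfrak{T}(\mathcal{R})$ of the generalized Berezin transform $\Gamma$ extends to a $*$-homomorphism $\overline{\Gamma}:\mathfrak{T}(\mathcal{R})\to C(\partial A)$, in the following sense: for every p-point $\alpha\in\partial A$ and every $T\in\mathfrak{T}(\mathcal{R})$ the limit $\lim_{z\to\alpha}\Gamma(T)(z)$ (with $z\in\Omega$) exists and equals $\overline{\Gamma}(T)(\alpha)\,I$, where $I$ is the identity of $\mathfrak{L}(\ell^2_m)$. The null space $\gamma(\mathfrak{T}(\mathcal{R}))$ of $\overline{\Gamma}$ is an ideal of $\mathfrak{T}(\mathcal{R})$ which contains $\mathfrak{C}(\mathcal{R})$.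
   Context: $A(\Omega)$ is the function algebra obtained as the supremum-norm completion of the set of functions holomorphic in some neighborhood of $\overline{\Omega}$. Let $\ell^2_m$ be the $m$-dimensional Hilbert space. A quasi-free Hilbert module $\mathcal{R}$ of rank $m$ over $A(\Omega)$ is the completion of an inner product on the algebraic tensor product $A(\Omega)\otimes\ell^2_m$ such that: (1) for each $z\in\Omega$ the evaluation map $\mathrm{eval}_z:A(\Omega)\otimes\ell^2_m\to\ell^2_m$, $\theta\otimes x\mapsto\theta(z)x$, is bounded, and these maps are locally uniformly bounded on $\Omega$; (2) $\|\sum\varphi\theta_i\otimes x_i\|_{\mathcal{R}}\le\|\varphi\|_{A(\Omega)}\|\sum\theta_i\otimes x_i\|_{\mathcal{R}}$ for $\varphi,\theta_i\in A(\Omega)$, $x_i\in\ell^2_m$; (3) for every sequence $(F_i)$ in $A(\Omega)\otimes\ell^2_m$ that is Cauchy in the $\mathcal{R}$-norm, $\mathrm{eval}_z(F_i)\to0$ for all $z\in\Omega$ if and only if $\|F_i\|_{\mathcal{R}}\to0$. Finite rank means $m<\infty$. Also write $\mathrm{eval}_z:\mathcal{R}\to\ell^2_m$ for the continuous extension (it is onto), and $M_\varphi\in\mathfrak{L}(\mathcal{R})$ for module multiplication by $\varphi$, where $\mathfrak{L}(\cdot)$ denotes bounded operators. Polar decomposition gives $\mathrm{eval}_z^*=V_zQ_z$ with $V_z:\ell^2_m\to\mathcal{R}$ an isometry and $Q_z$ positive invertible on $\ell^2_m$. The generalized Berezin transform of $X\in\mathfrak{L}(\mathcal{R})$ is the function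 $\Gamma(X)(z)=V_z^*XV_z\in\mathfrak{L}(\ell^2_m)$, $z\in\Omega$. $\mathfrak{T}(\mathcal{R})$ is the C*-algebra generated by $\{M_\varphi:\varphi\in A(\Omega)\}$, and $\mathfrak{C}(\mathcal{R})$ is its commutator ideal (the closed two-sided ideal of $\mathfrak{T}(\mathcal{R})$ generated by commutators of elements of $\mathfrak{T}(\mathcal{R})$). $M_A$ is the maximal ideal space of $A$, $\hat\varphi$ the Gelfand transform of $\varphi$, and $\partial A\subseteq M_A$ the Šilov boundary. $\Omega$ is regarded as a subset of $M_A$ via point evaluations, and $z\to\alpha$ refers to the topology of $M_A$. A point $\alpha\in M_A$ is a p-point if for every neighborhood $U$ of $\alpha$ in $M_A$ there is $\varphi\in A$ such that $|\hat\varphi|$ attains its maximum at $\alpha$ and at no point outside $U$. *)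

theory Defs
  imports "HOL-Analysis.Analysis"
begin

section \<open>Complex Hilbert spaces\<close>

text \<open>The distribution has only real inner products. The complex inner product is linear in its
  first argument.\<close>

class chilbert_space = banach +
  fixes scaleC :: "complex \<Rightarrow> 'a \<Rightarrow> 'a"  (infixr "*\<^sub>C" 75)
    and cinner :: "'a \<Rightarrow> 'a \<Rightarrow> complex"
  assumes scaleC_add_right: "c *\<^sub>C (x + y) = c *\<^sub>C x + c *\<^sub>C y"
    and scaleC_add_left: "(c + d) *\<^sub>C x = c *\<^sub>C x + d *\<^sub>C x"
    and scaleC_scaleC: "c *\<^sub>C d *\<^sub>C x = (c * d) *\<^sub>C x"
    and scaleR_scaleC: "r *\<^sub>R x = complex_of_real r *\<^sub>C x"
    and cinner_commute: "cinner x y = cnj (cinner y x)"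
    and cinner_add_left: "cinner (x + y) w = cinner x w + cinner y w"
    and cinner_scaleC_left: "cinner (c *\<^sub>C x) y = c * cinner x y"
    and cinner_self: "cinner x x = complex_of_real ((norm x)\<^sup>2)"

instantiation complex :: chilbert_space
begin

definition scaleC_complex :: "complex \<Rightarrow> complex \<Rightarrow> complex"
  where "scaleC_complex c x = c * x"

definition cinner_complex :: "complex \<Rightarrow> complex \<Rightarrow> complex"
  where "cinner_complex x y = x * cnj y"

instance
proof
  fix x :: complex
  show "cinner x x = complex_of_real ((norm x)\<^sup>2)"
    unfolding cinner_complex_def by (rule complex_norm_square [symmetric])
qed (auto simp: scaleC_complex_def cinner_complex_def algebra_simps scaleR_conv_of_real)

end

text \<open>In particular \<open>complex ^ 'm\<close>, with the library's Euclidean norm, is the Hilbert space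
  \<open>\<ell>\<^sup>2\<^sub>m\<close> for \<open>m = CARD('m)\<close>.\<close>

instantiation vec :: (chilbert_space, finite) chilbert_space
begin

definition scaleC_vec :: "complex \<Rightarrow> 'a ^ 'b \<Rightarrow> 'a ^ 'b"
  where "scaleC_vec c x = (\<chi> i. c *\<^sub>C (x $ i))"

definition cinner_vec :: "'a ^ 'b \<Rightarrow> 'a ^ 'b \<Rightarrow> complex"
  where "cinner_vec x y = (\<Sum>i\<in>UNIV. cinner (x $ i) (y $ i))"

instance
proof
  fix x y w :: "'a ^ 'b" and c d :: complex and r :: real
  show "c *\<^sub>C (x + y) = c *\<^sub>C x + c *\<^sub>C y" "(c + d) *\<^sub>C x = c *\<^sub>C x + d *\<^sub>C x"
    "c *\<^sub>C d *\<^sub>C x = (c * d) *\<^sub>C x" "r *\<^sub>R x = complex_of_real r *\<^sub>C x"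
    by (simp_all add: scaleC_vec_def vec_eq_iff scaleC_add_right scaleC_add_left scaleC_scaleC
        scaleR_scaleC)
  have "cnj (cinner y x) = (\<Sum>i\<in>UNIV. cnj (cinner (y $ i) (x $ i)))"
    by (simp add: cinner_vec_def)
  also have "\<dots> = cinner x y"
    unfolding cinner_vec_def by (intro sum.cong refl cinner_commute [symmetric])
  finally show "cinner x y = cnj (cinner y x)" ..
  show "cinner (x + y) w = cinner x w + cinner y w"
    by (simp add: cinner_vec_def cinner_add_left sum.distrib)
  show "cinner (c *\<^sub>C x) y = c * cinner x y"
    by (simp add: cinner_vec_def scaleC_vec_def cinner_scaleC_left sum_distrib_left)
  show "cinner x x = complex_of_real ((norm x)\<^sup>2)"
    by (simp add: cinner_vec_def cinner_self norm_vec_def L2_set_def sum_nonneg)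
qed

end

section \<open>Bounded operators\<close>

text \<open>The library type \<open>'a \<Rightarrow>\<^sub>L 'b\<close> consists of real-linear maps; the operators of
  interest are singled out by \<open>bop\<close>.\<close>

definition bop :: "('a::chilbert_space \<Rightarrow>\<^sub>L 'b::chilbert_space) set"
  where "bop = {T. \<forall>c x. blinfun_apply T (c *\<^sub>C x) = c *\<^sub>C blinfun_apply T x}"

definition op_scaleC :: "complex \<Rightarrow> ('a::chilbert_space \<Rightarrow>\<^sub>L 'b::chilbert_space) \<Rightarrow> 'a \<Rightarrow>\<^sub>L 'b"
  where "op_scaleC c T = Blinfun (\<lambda>x. c *\<^sub>C blinfun_apply T x)"

definition adj :: "('a::chilbert_space \<Rightarrow>\<^sub>L 'b::chilbert_space) \<Rightarrow> 'b \<Rightarrow>\<^sub>L 'a"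
  where "adj T = (THE S. \<forall>x y. cinner (blinfun_apply T x) y = cinner x (blinfun_apply S y))"

definition positive_op :: "('a::chilbert_space \<Rightarrow>\<^sub>L 'a) \<Rightarrow> bool"
  where "positive_op Q \<longleftrightarrow> Q \<in> bop \<and>
    (\<forall>x. Im (cinner (blinfun_apply Q x) x) = 0 \<and> 0 \<le> Re (cinner (blinfun_apply Q x) x))"

definition invertible_op :: "('a::chilbert_space \<Rightarrow>\<^sub>L 'a) \<Rightarrow> bool"
  where "invertible_op Q \<longleftrightarrow> (\<exists>Q'. Q o\<^sub>L Q' = id_blinfun \<and> Q' o\<^sub>L Q = id_blinfun)"

definition isometry_op :: "('a::chilbert_space \<Rightarrow>\<^sub>L 'b::chilbert_space) \<Rightarrow> bool"
  where "isometry_op V \<longleftrightarrow> V \<in> bop \<and> (\<forall>x. norm (blinfun_apply V x) = norm x)"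

definition cstar_subalgebra :: "('a::chilbert_space \<Rightarrow>\<^sub>L 'a) set \<Rightarrow> bool"
  where "cstar_subalgebra S \<longleftrightarrow> S \<subseteq> bop \<and> 0 \<in> S \<and> closed S \<and>
    (\<forall>X\<in>S. \<forall>Y\<in>S. X + Y \<in> S \<and> X o\<^sub>L Y \<in> S) \<and>
    (\<forall>c. \<forall>X\<in>S. op_scaleC c X \<in> S) \<and>
    (\<forall>X\<in>S. adj X \<in> S)"

definition cstar_generated :: "('a::chilbert_space \<Rightarrow>\<^sub>L 'a) set \<Rightarrow> ('a \<Rightarrow>\<^sub>L 'a) set"
  where "cstar_generated G = \<Inter> {S. cstar_subalgebra S \<and> G \<subseteq> S}"

definition closed_ideal :: "('a::chilbert_space \<Rightarrow>\<^sub>L 'a) set \<Rightarrow> ('a \<Rightarrow>\<^sub>L 'a) set \<Rightarrow> bool"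
  where "closed_ideal S J \<longleftrightarrow> J \<subseteq> S \<and> 0 \<in> J \<and> closed J \<and>
    (\<forall>X\<in>J. \<forall>Y\<in>J. X + Y \<in> J) \<and>
    (\<forall>c. \<forall>X\<in>J. op_scaleC c X \<in> J) \<and>
    (\<forall>X\<in>J. \<forall>Y\<in>S. X o\<^sub>L Y \<in> J \<and> Y o\<^sub>L X \<in> J)"

definition commutator_ideal :: "('a::chilbert_space \<Rightarrow>\<^sub>L 'a) set \<Rightarrow> ('a \<Rightarrow>\<^sub>L 'a) set"
  where "commutator_ideal S =
    \<Inter> {J. closed_ideal S J \<and> (\<forall>X\<in>S. \<forall>Y\<in>S. (X o\<^sub>L Y) - (Y o\<^sub>L X) \<in> J)}"

text \<open>A *-homomorphism from \<open>S\<close> to \<open>C(K)\<close>; only the values on \<open>S\<close> and \<open>K\<close> matter.\<close>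

definition star_hom_C ::
  "('a::chilbert_space \<Rightarrow>\<^sub>L 'a) set \<Rightarrow> 'k::topological_space set \<Rightarrow>
    (('a \<Rightarrow>\<^sub>L 'a) \<Rightarrow> 'k \<Rightarrow> complex) \<Rightarrow> bool"
  where "star_hom_C S K \<Phi> \<longleftrightarrow>
    (\<forall>X\<in>S. continuous_on K (\<Phi> X)) \<and>
    (\<forall>\<alpha>\<in>K.
      (\<forall>X\<in>S. \<forall>Y\<in>S. \<Phi> (X + Y) \<alpha> = \<Phi> X \<alpha> + \<Phi> Y \<alpha>) \<and>
      (\<forall>c. \<forall>X\<in>S. \<Phi> (op_scaleC c X) \<alpha> = c * \<Phi> X \<alpha>) \<and>
      (\<forall>X\<in>S. \<forall>Y\<in>S. \<Phi> (X o\<^sub>L Y) \<alpha> = \<Phi> X \<alpha> * \<Phi> Y \<alpha>) \<and>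
      (\<forall>X\<in>S. \<Phi> (adj X) \<alpha> = cnj (\<Phi> X \<alpha>)))"

definition null_space ::
  "('a::chilbert_space \<Rightarrow>\<^sub>L 'a) set \<Rightarrow> 'k set \<Rightarrow> (('a \<Rightarrow>\<^sub>L 'a) \<Rightarrow> 'k \<Rightarrow> complex) \<Rightarrow> ('a \<Rightarrow>\<^sub>L 'a) set"
  where "null_space S K \<Phi> = {X \<in> S. \<forall>\<alpha>\<in>K. \<Phi> X \<alpha> = 0}"

section \<open>The function algebra\<close>

definition holomorphic_Cn :: "(complex ^ 'n \<Rightarrow> complex) \<Rightarrow> (complex ^ 'n) set \<Rightarrow> bool"
  where "holomorphic_Cn f U \<longleftrightarrow>
    (\<forall>z\<in>U. \<exists>D. (f has_derivative D) (at z) \<and> (\<forall>c v. D (c *\<^sub>C v) = c * D v))"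

text \<open>The completion is realised as the uniform closure in \<open>C(closure \<Omega>)\<close>. Functions on
  \<open>closure \<Omega>\<close> are represented by their extension by zero, so that distinct functions here are
  distinct elements of the algebra and the algebra operations are pointwise. The unit is
  \<open>indicator (closure \<Omega>)\<close>.\<close>

definition fun_alg :: "(complex ^ 'n) set \<Rightarrow> (complex ^ 'n \<Rightarrow> complex) set"
  where "fun_alg \<Omega> = {f. (\<forall>z. z \<notin> closure \<Omega> \<longrightarrow> f z = 0) \<and>
    (\<forall>e>0. \<exists>g U. open U \<and> closure \<Omega> \<subseteq> U \<and> holomorphic_Cn g U \<and>
      (\<forall>z\<in>closure \<Omega>. cmod (f z - g z) < e))}"

definition sup_norm :: "(complex ^ 'n) set \<Rightarrow> (complex ^ 'n \<Rightarrow> complex) \<Rightarrow> real"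
  where "sup_norm \<Omega> f = (SUP z\<in>closure \<Omega>. cmod (f z))"

text \<open>The maximal ideal space as the space of nonzero multiplicative linear functionals. They are
  set to zero outside \<open>A\<close>, so the product topology of the function type induces the Gelfand
  (weak-*) topology. The Gelfand transform of \<open>f\<close> is \<open>\<lambda>\<alpha>. \<alpha> f\<close>.\<close>

definition max_ideal_space :: "('x \<Rightarrow> complex) set \<Rightarrow> (('x \<Rightarrow> complex) \<Rightarrow> complex) set"
  where "max_ideal_space A = {\<alpha>.
    (\<forall>f. f \<notin> A \<longrightarrow> \<alpha> f = 0) \<and> (\<exists>f\<in>A. \<alpha> f \<noteq> 0) \<and>
    (\<forall>f\<in>A. \<forall>g\<in>A. \<alpha> (\<lambda>x. f x + g x) = \<alpha> f + \<alpha> g) \<and>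
    (\<forall>c. \<forall>f\<in>A. \<alpha> (\<lambda>x. c * f x) = c * \<alpha> f) \<and>
    (\<forall>f\<in>A. \<forall>g\<in>A. \<alpha> (\<lambda>x. f x * g x) = \<alpha> f * \<alpha> g)}"

definition point_char :: "('x \<Rightarrow> complex) set \<Rightarrow> 'x \<Rightarrow> ('x \<Rightarrow> complex) \<Rightarrow> complex"
  where "point_char A z = (\<lambda>f. if f \<in> A then f z else 0)"

definition closed_boundary ::
  "('x \<Rightarrow> complex) set \<Rightarrow> (('x \<Rightarrow> complex) \<Rightarrow> complex) set \<Rightarrow> bool"
  where "closed_boundary A E \<longleftrightarrow> closedin (top_of_set (max_ideal_space A)) E \<and>
    (\<forall>f\<in>A. \<exists>\<alpha>\<in>E. \<forall>\<beta>\<in>max_ideal_space A. cmod (\<beta> f) \<le> cmod (\<alpha> f))"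

definition silov_boundary :: "('x \<Rightarrow> complex) set \<Rightarrow> (('x \<Rightarrow> complex) \<Rightarrow> complex) set"
  where "silov_boundary A = \<Inter> {E. closed_boundary A E}"

definition p_point :: "('x \<Rightarrow> complex) set \<Rightarrow> (('x \<Rightarrow> complex) \<Rightarrow> complex) \<Rightarrow> bool"
  where "p_point A \<alpha> \<longleftrightarrow> \<alpha> \<in> max_ideal_space A \<and>
    (\<forall>U. openin (top_of_set (max_ideal_space A)) U \<and> \<alpha> \<in> U \<longrightarrow>
      (\<exists>f\<in>A. (\<forall>\<beta>\<in>max_ideal_space A. cmod (\<beta> f) \<le> cmod (\<alpha> f)) \<and>
             (\<forall>\<beta>\<in>max_ideal_space A - U. cmod (\<beta> f) \<noteq> cmod (\<alpha> f))))"

text \<open>The filter of \<open>z \<rightarrow> \<alpha>\<close> with \<open>z \<in> \<Omega>\<close>, in the topology of the maximal ideal space.\<close>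

definition tends_to_char ::
  "(complex ^ 'n) set \<Rightarrow> ((complex ^ 'n \<Rightarrow> complex) \<Rightarrow> complex) \<Rightarrow> (complex ^ 'n) filter"
  where "tends_to_char \<Omega> \<alpha> =
    inf (filtercomap (point_char (fun_alg \<Omega>)) (nhds \<alpha>)) (principal \<Omega>)"

section \<open>Quasi-free Hilbert modules\<close>

text \<open>Since \<open>\<ell>\<^sup>2\<^sub>m\<close> is finite dimensional, the algebraic tensor product with the function algebra is
  canonically isomorphic to the span of the functions \<open>\<lambda>z. \<theta> z *\<^sub>C x\<close>, which represent the
  elementary tensors. Evaluation at \<open>z\<close> is then application to \<open>z\<close>.\<close>

definition alg_tensor :: "(complex ^ 'n) set \<Rightarrow> (complex ^ 'n \<Rightarrow> complex ^ 'm) set"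
  where "alg_tensor \<Omega> = {F. \<exists>(k::nat) \<theta> x. (\<forall>i<k. \<theta> i \<in> fun_alg \<Omega>) \<and>
    F = (\<lambda>z. \<Sum>i<k. \<theta> i z *\<^sub>C x i)}"

text \<open>The module is the type \<open>'r\<close> together with the canonical map \<open>\<iota>\<close> of the algebraic tensor
  product into its completion: a linear injection with dense range is the same thing as an inner
  product, namely \<open>cinner (\<iota> F) (\<iota> G)\<close>, together with a completion for it.\<close>

definition quasi_free ::
  "(complex ^ 'n) set \<Rightarrow> ((complex ^ 'n \<Rightarrow> complex ^ 'm) \<Rightarrow> 'r::chilbert_space) \<Rightarrow> bool"
  where "quasi_free \<Omega> \<iota> \<longleftrightarrow>
    (\<forall>F\<in>alg_tensor \<Omega>. \<forall>G\<in>alg_tensor \<Omega>. \<iota> (\<lambda>z. F z + G z) = \<iota> F + \<iota> G) \<and>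
    (\<forall>c. \<forall>F\<in>alg_tensor \<Omega>. \<iota> (\<lambda>z. c *\<^sub>C F z) = c *\<^sub>C \<iota> F) \<and>
    inj_on \<iota> (alg_tensor \<Omega>) \<and>
    closure (\<iota> ` alg_tensor \<Omega>) = UNIV \<and>
    (\<forall>z\<in>\<Omega>. \<exists>C. \<forall>F\<in>alg_tensor \<Omega>. norm (F z) \<le> C * norm (\<iota> F)) \<and>
    (\<forall>z\<in>\<Omega>. \<exists>U C. open U \<and> z \<in> U \<and>
      (\<forall>w\<in>U \<inter> \<Omega>. \<forall>F\<in>alg_tensor \<Omega>. norm (F w) \<le> C * norm (\<iota> F))) \<and>
    (\<forall>\<phi>\<in>fun_alg \<Omega>. \<forall>F\<in>alg_tensor \<Omega>.
      norm (\<iota> (\<lambda>z. \<phi> z *\<^sub>C F z)) \<le> sup_norm \<Omega> \<phi> * norm (\<iota> F)) \<and>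
    (\<forall>F. (\<forall>i::nat. F i \<in> alg_tensor \<Omega>) \<and> Cauchy (\<lambda>i. \<iota> (F i)) \<longrightarrow>
      ((\<forall>z\<in>\<Omega>. (\<lambda>i. F i z) \<longlonglongrightarrow> 0) \<longleftrightarrow> (\<lambda>i. norm (\<iota> (F i))) \<longlonglongrightarrow> 0))"

text \<open>The continuous extensions from the dense range of \<open>\<iota>\<close>.\<close>

definition eval_op ::
  "(complex ^ 'n) set \<Rightarrow> ((complex ^ 'n \<Rightarrow> complex ^ 'm) \<Rightarrow> 'r::chilbert_space) \<Rightarrow>
    complex ^ 'n \<Rightarrow> 'r \<Rightarrow>\<^sub>L (complex ^ 'm)"
  where "eval_op \<Omega> \<iota> z = (THE E. \<forall>F\<in>alg_tensor \<Omega>. blinfun_apply E (\<iota> F) = F z)"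

definition mult_op ::
  "(complex ^ 'n) set \<Rightarrow> ((complex ^ 'n \<Rightarrow> complex ^ 'm) \<Rightarrow> 'r::chilbert_space) \<Rightarrow>
    (complex ^ 'n \<Rightarrow> complex) \<Rightarrow> 'r \<Rightarrow>\<^sub>L 'r"
  where "mult_op \<Omega> \<iota> \<phi> =
    (THE M. \<forall>F\<in>alg_tensor \<Omega>. blinfun_apply M (\<iota> F) = \<iota> (\<lambda>z. \<phi> z *\<^sub>C F z))"

text \<open>The factor \<open>V\<^sub>z\<close> of the polar decomposition of the adjoint of evaluation at \<open>z\<close>; it is
  uniquely determined.\<close>

definition polar_isometry ::
  "(complex ^ 'n) set \<Rightarrow> ((complex ^ 'n \<Rightarrow> complex ^ 'm) \<Rightarrow> 'r::chilbert_space) \<Rightarrow>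
    complex ^ 'n \<Rightarrow> (complex ^ 'm) \<Rightarrow>\<^sub>L 'r"
  where "polar_isometry \<Omega> \<iota> z = (SOME V. isometry_op V \<and>
    (\<exists>Q. positive_op Q \<and> invertible_op Q \<and> adj (eval_op \<Omega> \<iota> z) = V o\<^sub>L Q))"

definition berezin ::
  "(complex ^ 'n) set \<Rightarrow> ((complex ^ 'n \<Rightarrow> complex ^ 'm) \<Rightarrow> 'r::chilbert_space) \<Rightarrow>
    ('r \<Rightarrow>\<^sub>L 'r) \<Rightarrow> complex ^ 'n \<Rightarrow> (complex ^ 'm) \<Rightarrow>\<^sub>L (complex ^ 'm)"
  where "berezin \<Omega> \<iota> X z =
    adj (polar_isometry \<Omega> \<iota> z) o\<^sub>L X o\<^sub>L polar_isometry \<Omega> \<iota> z"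

definition toeplitz_alg ::
  "(complex ^ 'n) set \<Rightarrow> ((complex ^ 'n \<Rightarrow> complex ^ 'm) \<Rightarrow> 'r::chilbert_space) \<Rightarrow> ('r \<Rightarrow>\<^sub>L 'r) set"
  where "toeplitz_alg \<Omega> \<iota> = cstar_generated (mult_op \<Omega> \<iota> ` fun_alg \<Omega>)"

end

theory Submission
  imports Defs
begin

text \<open>
  Write \<open>V z\<close> for the isometric factor of \<open>adj (E z)\<close>, where \<open>E z\<close> is evaluation at \<open>z\<close>. Since \<open>E z\<close>
  intertwines \<open>M \<phi>\<close> with the scalar \<open>\<phi> z\<close>, the range of \<open>V z\<close> consists of eigenvectors of
  \<open>adj (M \<phi>)\<close> for the eigenvalue \<open>cnj (\<phi> z)\<close> (lemma \<open>adj_mult_op_polar_isometry\<close>). They are in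
  general not eigenvectors of \<open>M \<phi>\<close>, but they almost are for suitable \<open>z\<close> approaching the
  Silov boundary.

  The reason is localization by peak functions. If \<open>g\<close> has sup norm at most 1 and \<open>g z\<close> is close to
  1, then \<open>M g\<close> is a contraction that almost fixes the range of \<open>V z\<close>, because
  \<open>cinner (M g x) x = g z * (norm x)\<^sup>2\<close> there. Hence \<open>M \<psi>\<close> is almost \<open>M (\<psi> g)\<close> on that range, and the
  latter operator has small norm as soon as \<open>g\<close> is small wherever \<open>\<psi>\<close> is not. Applied to
  \<open>\<psi> - \<alpha> \<psi>\<close> and to a high power \<open>g\<close> of a function that peaks only in a small neighbourhood of the
  character \<open>\<alpha>\<close>, this shows that \<open>M \<psi>\<close> acts on the range of \<open>V z\<close> almost as the scalar \<open>\<alpha> \<psi>\<close>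
  (lemma \<open>peak_localization\<close>).

  Let the localizing filter of \<open>\<alpha>\<close> describe the points \<open>z\<close> at which finitely many \<open>M \<psi>\<close> act almost
  as the scalars \<open>\<alpha> \<psi>\<close>. It is nontrivial for every \<open>\<alpha>\<close> in the Silov boundary: the complement of a
  neighbourhood of \<open>\<alpha>\<close> is closed and misses \<open>\<alpha>\<close>, so it is not a boundary, and this means precisely
  that some function peaks only inside the neighbourhood. If \<open>\<alpha>\<close> is a p-point, the function can be
  chosen to peak at \<open>\<alpha>\<close>, so that the filter of \<open>z \<rightarrow> \<alpha>\<close> refines the localizing filter.

  The operators \<open>T\<close> for which \<open>T V z - c V z\<close> and \<open>adj T V z - cnj c V z\<close> tend to 0 along the
  localizing filter, with \<open>c\<close> depending continuously on \<open>\<alpha>\<close>, form a C*-algebra (lemma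
  \<open>cstar_subalgebra_continuous_symbol\<close>), and it contains every \<open>M \<psi>\<close> with \<open>c = \<alpha> \<psi>\<close>. It therefore
  contains the Toeplitz algebra. The scalar \<open>c\<close> is unique and bounded by \<open>norm T\<close>, so \<open>T \<mapsto> c\<close> is a
  contractive *-homomorphism into \<open>C(\<partial>A)\<close>. Its kernel is a closed ideal, which contains all
  commutators because \<open>C(\<partial>A)\<close> is commutative. At a p-point, compressing \<open>T V z - c V z\<close> by \<open>V z\<^sup>*\<close>
  gives the limit of the Berezin transform.

  That \<open>V z\<close> exists is the polar decomposition of \<open>adj (E z)\<close>. It needs an invertible square root of
  \<open>E z (adj (E z))\<close>, which is obtained from Banach's fixed point theorem: \<open>(1 - Y)\<^sup>2 = 1 - B\<close> says that
  \<open>Y\<close> is fixed by \<open>Y \<mapsto> (B + Y\<^sup>2) / 2\<close>.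
\<close>

section \<open>Complex inner products\<close>

lemma scaleC_zero_right [simp]: "c *\<^sub>C (0::'a::chilbert_space) = 0"
  using scaleC_add_right[of c "0::'a" 0] by simp

lemma scaleC_zero_left [simp]: "0 *\<^sub>C (x::'a::chilbert_space) = 0"
  using scaleC_add_left[of 0 0 x] by simp

lemma scaleC_one [simp]: "1 *\<^sub>C (x::'a::chilbert_space) = x"
  using scaleR_scaleC[of 1 x] by simp

lemma scaleC_minus_right: "c *\<^sub>C (- x::'a::chilbert_space) = - (c *\<^sub>C x)"
  using scaleC_add_right[of c x "- x"] by (simp add: eq_neg_iff_add_eq_0 add.commute)

lemma scaleC_minus_left: "(- c) *\<^sub>C (x::'a::chilbert_space) = - (c *\<^sub>C x)"
  using scaleC_add_left[of c "- c" x] by (simp add: eq_neg_iff_add_eq_0 add.commute)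

lemma scaleC_diff_right: "c *\<^sub>C (x - y::'a::chilbert_space) = c *\<^sub>C x - c *\<^sub>C y"
  using scaleC_add_right[of c x "- y"] by (simp add: scaleC_minus_right)

lemma scaleC_diff_left: "(c - d) *\<^sub>C (x::'a::chilbert_space) = c *\<^sub>C x - d *\<^sub>C x"
  using scaleC_add_left[of c "- d" x] by (simp add: scaleC_minus_left)

lemma cinner_add_right: "cinner x (y + w) = cinner x y + cinner x (w::'a::chilbert_space)"
  using cinner_commute[of x "y + w"] cinner_commute[of x y] cinner_commute[of x w]
  by (simp add: cinner_add_left)

lemma cinner_scaleC_right: "cinner x (c *\<^sub>C y) = cnj c * cinner x (y::'a::chilbert_space)"
  using cinner_commute[of x "c *\<^sub>C y"] cinner_commute[of x y] by (simp add: cinner_scaleC_left)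

lemma cinner_zero_left [simp]: "cinner 0 (y::'a::chilbert_space) = 0"
  using cinner_add_left[of 0 0 y] by simp

lemma cinner_zero_right [simp]: "cinner (y::'a::chilbert_space) 0 = 0"
  using cinner_add_right[of y 0 0] by simp

lemma cinner_minus_left: "cinner (- x) (y::'a::chilbert_space) = - cinner x y"
  using cinner_add_left[of x "- x" y] by (simp add: eq_neg_iff_add_eq_0 add.commute)

lemma cinner_minus_right: "cinner x (- y::'a::chilbert_space) = - cinner x y"
  using cinner_add_right[of x y "- y"] by (simp add: eq_neg_iff_add_eq_0 add.commute)

lemma cinner_diff_left: "cinner (x - y) (w::'a::chilbert_space) = cinner x w - cinner y w"
  using cinner_add_left[of x "- y" w] by (simp add: cinner_minus_left)

lemma cinner_diff_right: "cinner x (y - w::'a::chilbert_space) = cinner x y - cinner x w"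
  using cinner_add_right[of x y "- w"] by (simp add: cinner_minus_right)

lemmas cinner_simps = cinner_add_left cinner_add_right cinner_diff_left cinner_diff_right
  cinner_scaleC_left cinner_scaleC_right cinner_minus_left cinner_minus_right

lemma Re_cinner_self: "Re (cinner x x) = (norm (x::'a::chilbert_space))\<^sup>2"
  by (simp add: cinner_self)

lemma norm_scaleC [simp]: "norm (c *\<^sub>C x) = cmod c * norm (x::'a::chilbert_space)"
proof -
  have "complex_of_real ((norm (c *\<^sub>C x))\<^sup>2) = complex_of_real ((cmod c * norm x)\<^sup>2)"
    unfolding cinner_self[symmetric] cinner_simps
    by (simp add: cinner_self power_mult_distrib complex_norm_square mult_ac del: of_real_power)
  then have "(norm (c *\<^sub>C x))\<^sup>2 = (cmod c * norm x)\<^sup>2"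
    using of_real_eq_iff by blast
  then show ?thesis
    by (metis abs_norm_cancel abs_of_nonneg mult_nonneg_nonneg norm_ge_zero real_sqrt_abs)
qed

lemma norm_add_square:
  "(norm (x + y::'a::chilbert_space))\<^sup>2 = (norm x)\<^sup>2 + 2 * Re (cinner x y) + (norm y)\<^sup>2"
proof -
  have "Re (cinner y x) = Re (cinner x y)"
    using cinner_commute[of y x] by simp
  then show ?thesis
    unfolding Re_cinner_self[symmetric] by (simp add: cinner_simps)
qed

lemma norm_diff_square:
  "(norm (x - y::'a::chilbert_space))\<^sup>2 = (norm x)\<^sup>2 - 2 * Re (cinner x y) + (norm y)\<^sup>2"
  using norm_add_square[of x "- y"] by (simp add: cinner_simps)

lemma norm_diff_projection_square:
  assumes "(v::'a::chilbert_space) \<noteq> 0"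
  shows "(norm (x - (cinner x v / (norm v)\<^sup>2) *\<^sub>C v))\<^sup>2 = (norm x)\<^sup>2 - (cmod (cinner x v))\<^sup>2 / (norm v)\<^sup>2"
proof -
  let ?a = "cinner x v"
  have "Re (cinner x ((?a / (norm v)\<^sup>2) *\<^sub>C v)) = Re (cnj ?a * ?a / of_real ((norm v)\<^sup>2))"
    by (simp add: cinner_simps)
  also have "\<dots> = (cmod ?a)\<^sup>2 / (norm v)\<^sup>2"
    unfolding Re_divide_of_real by (simp add: cmod_def power2_eq_square)
  finally have 1: "Re (cinner x ((?a / (norm v)\<^sup>2) *\<^sub>C v)) = (cmod ?a)\<^sup>2 / (norm v)\<^sup>2" .
  have 2: "(norm ((?a / (norm v)\<^sup>2) *\<^sub>C v))\<^sup>2 = (cmod ?a)\<^sup>2 / (norm v)\<^sup>2"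
  proof -
    have "(norm ((?a / (norm v)\<^sup>2) *\<^sub>C v))\<^sup>2 = (cmod ?a / (norm v)\<^sup>2 * norm v)\<^sup>2"
      by (simp add: norm_divide norm_power)
    also have "\<dots> = (cmod ?a)\<^sup>2 / (norm v)\<^sup>2"
      using assms by (simp add: power2_eq_square)
    finally show ?thesis .
  qed
  show ?thesis
    unfolding norm_diff_square 1 2 by simp
qed

lemma cmod_cinner_le: "cmod (cinner x y) \<le> norm x * norm (y::'a::chilbert_space)"
proof (cases "y = 0")
  case False
  have "0 \<le> (norm x)\<^sup>2 - (cmod (cinner x y))\<^sup>2 / (norm y)\<^sup>2"
    using norm_diff_projection_square[OF False, of x] by (metis zero_le_power2)
  then have "(cmod (cinner x y))\<^sup>2 \<le> (norm x * norm y)\<^sup>2"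
    using False by (simp add: field_simps power_mult_distrib)
  then show ?thesis
    by (rule power2_le_imp_le) simp
qed simp

lemma cinner_left_eqI:
  assumes "\<And>x. cinner x y = cinner x (w::'a::chilbert_space)"
  shows "y = w"
proof -
  have "cinner (y - w) (y - w) = 0"
    unfolding cinner_diff_right using assms by simp
  then show ?thesis
    by (simp add: cinner_self)
qed

section \<open>Operators and their adjoints\<close>

lemma bounded_linear_scaleC: "bounded_linear (\<lambda>x::'a::chilbert_space. c *\<^sub>C x)"
proof
  show "\<exists>K. \<forall>x::'a. norm (c *\<^sub>C x) \<le> norm x * K"
    by (rule exI[of _ "cmod c"]) (simp add: mult.commute)
qed (simp_all add: scaleC_add_right scaleR_scaleC scaleC_scaleC mult.commute)

lemma op_scaleC_apply [simp]: "blinfun_apply (op_scaleC c T) x = c *\<^sub>C blinfun_apply T x"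
proof -
  have "bounded_linear (\<lambda>x. c *\<^sub>C blinfun_apply T x)"
    using bounded_linear_compose[OF bounded_linear_scaleC blinfun.bounded_linear_right[of T], of c]
    by simp
  then show ?thesis
    unfolding op_scaleC_def by (simp add: bounded_linear_Blinfun_apply)
qed

lemma norm_op_scaleC: "norm (op_scaleC c T) = cmod c * norm (T :: 'a::chilbert_space \<Rightarrow>\<^sub>L 'b::chilbert_space)"
proof (rule antisym)
  have le: "norm (op_scaleC d S) \<le> cmod d * norm S" for d and S :: "'a \<Rightarrow>\<^sub>L 'b"
    using norm_blinfun[of S] by (intro norm_blinfun_bound) (auto simp: mult.assoc mult_left_mono)
  show "norm (op_scaleC c T) \<le> cmod c * norm T"
    by (rule le)
  show "cmod c * norm T \<le> norm (op_scaleC c T)"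
  proof (cases "c = 0")
    case False
    have "T = op_scaleC (1 / c) (op_scaleC c T)"
      using False by (intro blinfun_eqI) (simp add: scaleC_scaleC)
    then have "norm T \<le> cmod (1 / c) * norm (op_scaleC c T)"
      using le[of "1 / c" "op_scaleC c T"] by simp
    then show ?thesis
      using False by (simp add: norm_divide field_simps)
  qed simp
qed

lemma bopD: "T \<in> bop \<Longrightarrow> blinfun_apply T (c *\<^sub>C x) = c *\<^sub>C blinfun_apply T x"
  by (simp add: bop_def)

lemma bop_zero [simp]: "0 \<in> bop"
  and bop_id [simp]: "id_blinfun \<in> bop"
  and bop_add: "S \<in> bop \<Longrightarrow> T \<in> bop \<Longrightarrow> S + T \<in> bop"
  and bop_diff: "S \<in> bop \<Longrightarrow> T \<in> bop \<Longrightarrow> S - T \<in> bop"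
  and bop_scaleC: "S \<in> bop \<Longrightarrow> op_scaleC c S \<in> bop"
  and bop_scaleR: "S \<in> bop \<Longrightarrow> r *\<^sub>R S \<in> bop"
  by (simp_all add: bop_def blinfun.add_left blinfun.diff_left scaleC_add_right scaleC_diff_right
      scaleC_scaleC scaleR_scaleC blinfun.scaleR_left mult.commute)

lemma bop_compose: "S \<in> bop \<Longrightarrow> T \<in> bop \<Longrightarrow> S o\<^sub>L T \<in> bop"
  by (simp add: bop_def)

lemma closed_bop: "closed (bop :: ('a::chilbert_space \<Rightarrow>\<^sub>L 'b::chilbert_space) set)"
proof -
  have "closed {T :: 'a \<Rightarrow>\<^sub>L 'b. blinfun_apply T (c *\<^sub>C x) = c *\<^sub>C blinfun_apply T x}" for c x
    by (intro closed_Collect_eq continuous_intros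
        bounded_linear.continuous_on[OF bounded_linear_scaleC])
  then have "closed (\<Inter>c. \<Inter>x. {T :: 'a \<Rightarrow>\<^sub>L 'b. blinfun_apply T (c *\<^sub>C x) = c *\<^sub>C blinfun_apply T x})"
    by (intro closed_INT ballI)
  then show ?thesis
    by (simp add: bop_def Collect_all_eq)
qed

text \<open>The element of least norm in the closed convex set \<open>f x = 1\<close> is orthogonal to the kernel of
  \<open>f\<close>, and a multiple of it represents \<open>f\<close>.\<close>

lemma riesz_representation:
  fixes f :: "'a::chilbert_space \<Rightarrow> complex"
  assumes add: "\<And>x y. f (x + y) = f x + f y"
    and scale: "\<And>c x. f (c *\<^sub>C x) = c * f x"
    and bound: "\<And>x. cmod (f x) \<le> K * norm x"
  shows "\<exists>y. \<forall>x. f x = cinner x y"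
proof (cases "\<forall>x. f x = 0")
  case True
  then show ?thesis
    by (intro exI[of _ 0]) simp
next
  case False
  define D where "D = {x. f x = 1}"
  define d where "d = Inf (norm ` D)"
  have diff: "f (x - y) = f x - f y" for x y
    using add[of "x - y" y] by (simp add: algebra_simps)
  have lin: "bounded_linear f"
    using add scale bound
    by (intro bounded_linear_intro[where K = K])
       (auto simp: scaleR_scaleC scaleC_complex_def mult.commute)
  obtain x1 where x1: "f x1 \<noteq> 0"
    using False by blast
  have "(1 / f x1) *\<^sub>C x1 \<in> D"
    using x1 by (simp add: D_def scale)
  then have ne: "norm ` D \<noteq> {}"
    by blast
  have bdd: "bdd_below (norm ` D)"
    by (rule bdd_belowI[of _ 0]) auto
  have d_le: "d \<le> norm x" if "x \<in> D" for x
    unfolding d_def using that bdd by (auto intro: cInf_lower)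
  have d0: "0 \<le> d"
    unfolding d_def by (rule cInf_greatest[OF ne]) auto
  have "\<exists>x. x \<in> D \<and> norm x < d + 1 / Suc n" for n
    using cInf_lessD[OF ne, of "d + 1 / Suc n"] unfolding d_def by force
  then obtain X where X: "\<And>n. X n \<in> D" "\<And>n. norm (X n) < d + 1 / Suc n"
    by metis
  have lim: "(\<lambda>n. norm (X n)) \<longlonglongrightarrow> d"
  proof (rule tendsto_sandwich[of "\<lambda>_. d" _ _ "\<lambda>n. d + 1 / Suc n"])
    show "(\<lambda>n. d + 1 / Suc n) \<longlonglongrightarrow> d"
      using tendsto_add[OF tendsto_const[of d] LIMSEQ_inverse_real_of_nat] by (simp add: field_simps)
  qed (use X d_le in \<open>auto intro!: always_eventually less_imp_le\<close>)
  then have lim2: "(\<lambda>n. (norm (X n))\<^sup>2) \<longlonglongrightarrow> d\<^sup>2"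
    by (intro tendsto_intros)
  have "Cauchy X"
  proof (rule metric_CauchyI)
    fix e :: real assume e: "e > 0"
    have "\<forall>\<^sub>F n in sequentially. (norm (X n))\<^sup>2 < d\<^sup>2 + e\<^sup>2 / 4"
      using e by (intro order_tendstoD(2)[OF lim2]) simp
    then obtain N where N: "\<And>n. n \<ge> N \<Longrightarrow> (norm (X n))\<^sup>2 < d\<^sup>2 + e\<^sup>2 / 4"
      by (auto simp: eventually_sequentially)
    have "dist (X m) (X n) < e" if "m \<ge> N" "n \<ge> N" for m n
    proof -
      have "(1 / 2) *\<^sub>C (X m + X n) \<in> D"
        using X(1)[of m] X(1)[of n] by (simp add: D_def scale add)
      then have "d \<le> norm (X m + X n) / 2"
        using d_le[of "(1 / 2) *\<^sub>C (X m + X n)"] by (simp add: norm_divide)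
      then have "(2 * d)\<^sup>2 \<le> (norm (X m + X n))\<^sup>2"
        using d0 by (intro power_mono) auto
      \<comment> \<open>The parallelogram law.\<close>
      moreover have "(norm (X m - X n))\<^sup>2 + (norm (X m + X n))\<^sup>2 = 2 * (norm (X m))\<^sup>2 + 2 * (norm (X n))\<^sup>2"
        unfolding norm_add_square norm_diff_square by simp
      ultimately have "(norm (X m - X n))\<^sup>2 < e\<^sup>2"
        using N[OF that(1)] N[OF that(2)] by (simp add: power_mult_distrib)
      then show ?thesis
        using e by (simp add: dist_norm power_less_imp_less_base)
    qed
    then show "\<exists>M. \<forall>m\<ge>M. \<forall>n\<ge>M. dist (X m) (X n) < e"
      by blast
  qed
  then obtain x0 where x0: "X \<longlonglongrightarrow> x0"
    using Cauchy_convergent_iff convergent_def by blast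
  have "(\<lambda>n. f (X n)) \<longlonglongrightarrow> f x0"
    by (rule bounded_linear.tendsto[OF lin x0])
  moreover have "f (X n) = 1" for n
    using X(1)[of n] by (simp add: D_def)
  ultimately have f1: "f x0 = 1"
    by (simp add: LIMSEQ_const_iff)
  have normx0: "norm x0 = d"
    using LIMSEQ_unique[OF tendsto_norm[OF x0] lim] .
  have "x0 \<noteq> 0"
    using f1 scale[of 0 0] by auto
  have orth: "cinner v x0 = 0" if "f v = 0" for v
  proof (cases "v = 0")
    case False
    let ?w = "x0 - (cinner x0 v / (norm v)\<^sup>2) *\<^sub>C v"
    have "f ?w = 1"
      using that f1 by (simp add: diff scale)
    then have "d\<^sup>2 \<le> (norm ?w)\<^sup>2"
      using d_le[of ?w] d0 by (simp add: D_def power_mono)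
    then have "(cmod (cinner x0 v))\<^sup>2 / (norm v)\<^sup>2 \<le> 0"
      unfolding norm_diff_projection_square[OF False] using normx0 by simp
    then have "cinner x0 v = 0"
      using False by (simp add: divide_le_0_iff)
    then show ?thesis
      by (subst cinner_commute) simp
  qed simp
  have "f x = cinner x ((1 / (norm x0)\<^sup>2) *\<^sub>C x0)" for x
  proof -
    have "f (x - f x *\<^sub>C x0) = 0"
      by (simp add: diff scale f1)
    then have "cinner x x0 = f x * (norm x0)\<^sup>2"
      using orth[of "x - f x *\<^sub>C x0"] by (simp add: cinner_simps cinner_self)
    then show ?thesis
      using \<open>x0 \<noteq> 0\<close> by (simp add: cinner_simps)
  qed
  then show ?thesis
    by blast
qed

lemma adj_ex1:
  fixes T :: "'a::chilbert_space \<Rightarrow>\<^sub>L 'b::chilbert_space"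
  assumes T: "T \<in> bop"
  shows "\<exists>!S. \<forall>x y. cinner (blinfun_apply T x) y = cinner x (blinfun_apply S y)"
proof (rule ex_ex1I)
  have "\<exists>w. \<forall>x. cinner (blinfun_apply T x) y = cinner x w" for y
  proof (rule riesz_representation[where K = "norm T * norm y"])
    show "cmod (cinner (blinfun_apply T x) y) \<le> norm T * norm y * norm x" for x
      using cmod_cinner_le[of "blinfun_apply T x" y]
        mult_right_mono[OF norm_blinfun[of T x] norm_ge_zero[of y]] by (simp add: mult_ac)
  qed (simp_all add: blinfun.add_right bopD[OF T] cinner_simps)
  then obtain S where S: "\<And>x y. cinner (blinfun_apply T x) y = cinner x (S y)"
    by metis
  have "bounded_linear S"
  proof (rule bounded_linear_intro[where K = "norm T"])
    show "S (x + y) = S x + S y" for x y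
      by (rule cinner_left_eqI) (simp add: S[symmetric] cinner_simps)
    show "S (r *\<^sub>R x) = r *\<^sub>R S x" for r x
      by (rule cinner_left_eqI) (simp add: S[symmetric] cinner_simps scaleR_scaleC)
    show "norm (S x) \<le> norm x * norm T" for x
    proof -
      have "(norm (S x))\<^sup>2 = Re (cinner (blinfun_apply T (S x)) x)"
        by (simp add: S Re_cinner_self)
      also have "\<dots> \<le> norm (blinfun_apply T (S x)) * norm x"
        using complex_Re_le_cmod cmod_cinner_le order_trans by blast
      also have "\<dots> \<le> norm T * norm (S x) * norm x"
        by (intro mult_right_mono norm_blinfun norm_ge_zero)
      finally have "norm (S x) * norm (S x) \<le> norm (S x) * (norm x * norm T)"
        by (simp add: power2_eq_square mult_ac)
      then show ?thesis
        by (cases "S x = 0") auto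
    qed
  qed
  then show "\<exists>S. \<forall>x y. cinner (blinfun_apply T x) y = cinner x (blinfun_apply S y)"
    using S by (intro exI[of _ "Blinfun S"]) (simp add: bounded_linear_Blinfun_apply)
next
  fix S S' :: "'b \<Rightarrow>\<^sub>L 'a"
  assume "\<forall>x y. cinner (blinfun_apply T x) y = cinner x (blinfun_apply S y)"
    and "\<forall>x y. cinner (blinfun_apply T x) y = cinner x (blinfun_apply S' y)"
  then show "S = S'"
    by (metis blinfun_eqI cinner_left_eqI)
qed

lemma cinner_adj_right:
  "T \<in> bop \<Longrightarrow> cinner x (blinfun_apply (adj T) y) = cinner (blinfun_apply T x) y"
  unfolding adj_def by (rule theI'[OF adj_ex1, rule_format, symmetric])

lemma cinner_adj_left:
  "T \<in> bop \<Longrightarrow> cinner (blinfun_apply (adj T) y) x = cinner y (blinfun_apply T x)"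
  using cinner_adj_right[of T x y] cinner_commute[of "blinfun_apply (adj T) y" x]
    cinner_commute[of y "blinfun_apply T x"] by simp

lemma adj_eqI:
  assumes "T \<in> bop" "\<And>x y. cinner (blinfun_apply T x) y = cinner x (blinfun_apply S y)"
  shows "adj T = S"
  unfolding adj_def by (rule the1_equality[OF adj_ex1[OF assms(1)]]) (use assms(2) in blast)

lemma adj_bop [simp]:
  assumes "T \<in> bop"
  shows "adj T \<in> bop"
proof -
  have "blinfun_apply (adj T) (c *\<^sub>C y) = c *\<^sub>C blinfun_apply (adj T) y" for c y
    by (rule cinner_left_eqI) (simp add: cinner_adj_right[OF assms] cinner_simps)
  then show ?thesis
    by (simp add: bop_def)
qed

lemma adj_adj: "T \<in> bop \<Longrightarrow> adj (adj T) = T"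
  by (rule adj_eqI) (auto simp: cinner_adj_left)

lemma adj_add: "S \<in> bop \<Longrightarrow> T \<in> bop \<Longrightarrow> adj (S + T) = adj S + adj T"
  by (rule adj_eqI) (auto simp: bop_add blinfun.add_left cinner_simps cinner_adj_right)

lemma adj_diff: "S \<in> bop \<Longrightarrow> T \<in> bop \<Longrightarrow> adj (S - T) = adj S - adj T"
  by (rule adj_eqI) (auto simp: bop_diff blinfun.diff_left cinner_simps cinner_adj_right)

lemma adj_scaleC: "T \<in> bop \<Longrightarrow> adj (op_scaleC c T) = op_scaleC (cnj c) (adj T)"
  by (rule adj_eqI) (auto simp: bop_scaleC cinner_simps cinner_adj_right)

lemma adj_compose: "S \<in> bop \<Longrightarrow> T \<in> bop \<Longrightarrow> adj (S o\<^sub>L T) = adj T o\<^sub>L adj S"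
  by (rule adj_eqI) (auto simp: bop_compose cinner_adj_right)

lemma norm_adj: "T \<in> bop \<Longrightarrow> norm (adj T) = norm T"
proof -
  have le: "norm (adj T) \<le> norm T" if T: "T \<in> bop" for T :: "'c::chilbert_space \<Rightarrow>\<^sub>L 'd::chilbert_space"
  proof (rule norm_blinfun_bound)
    fix y
    let ?w = "blinfun_apply (adj T) y"
    have "(norm ?w)\<^sup>2 = Re (cinner (blinfun_apply T ?w) y)"
      using cinner_adj_right[OF T, of ?w y] by (simp add: Re_cinner_self[symmetric])
    also have "\<dots> \<le> norm (blinfun_apply T ?w) * norm y"
      using complex_Re_le_cmod cmod_cinner_le order_trans by blast
    also have "\<dots> \<le> norm T * norm ?w * norm y"
      by (intro mult_right_mono norm_blinfun norm_ge_zero)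
    finally have "norm ?w * norm ?w \<le> norm ?w * (norm T * norm y)"
      by (simp add: power2_eq_square mult_ac)
    then show "norm ?w \<le> norm T * norm y"
      by (cases "?w = 0") auto
  qed simp
  assume "T \<in> bop"
  then show ?thesis
    using le[of T] le[of "adj T"] by (simp add: adj_adj)
qed

lemma isometry_adj_compose:
  assumes "isometry_op V"
  shows "adj V o\<^sub>L V = id_blinfun"
proof -
  have V: "V \<in> bop" and nV: "\<And>x. norm (blinfun_apply V x) = norm x"
    using assms by (auto simp: isometry_op_def)
  \<comment> \<open>Polarization: the norm determines the real part, and replacing \<open>x\<close> by \<open>\<i> x\<close> the imaginary part.\<close>
  have re: "Re (cinner (blinfun_apply V x) (blinfun_apply V y)) = Re (cinner x y)" for x y
    using norm_add_square[of "blinfun_apply V x" "blinfun_apply V y"] norm_add_square[of x y] nV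
    by (simp flip: blinfun.add_right)
  have "cinner (blinfun_apply V x) (blinfun_apply V y) = cinner x y" for x y
    using re[of x y] re[of "\<i> *\<^sub>C x" y]
    by (simp add: bopD[OF V] cinner_simps complex_eq_iff)
  then have "blinfun_apply (adj V) (blinfun_apply V x) = x" for x
    by (intro cinner_left_eqI[of _ x]) (simp add: cinner_adj_right[OF V])
  then show ?thesis
    by (auto intro: blinfun_eqI)
qed

section \<open>Polar decomposition\<close>

lemma bounded_linear_cinner_left: "bounded_linear (\<lambda>x::'a::chilbert_space. cinner x y)"
  using cmod_cinner_le[of _ y]
  by (intro bounded_linear_intro[where K = "norm y"])
     (simp_all add: cinner_simps scaleR_scaleC scaleC_complex_def)

lemma bounded_linear_cinner_right: "bounded_linear (\<lambda>y::'a::chilbert_space. cinner x y)"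
  using cmod_cinner_le[of x]
  by (intro bounded_linear_intro[where K = "norm x"])
     (simp_all add: cinner_simps scaleR_scaleC scaleC_complex_def mult.commute)

lemma closed_selfadjoint: "closed {Y \<in> bop. adj Y = (Y :: 'a::chilbert_space \<Rightarrow>\<^sub>L 'a)}"
proof -
  have "closed {Y :: 'a \<Rightarrow>\<^sub>L 'a. cinner (blinfun_apply Y x) y = cinner x (blinfun_apply Y y)}" for x y
    by (intro closed_Collect_eq bounded_linear.continuous_on[OF bounded_linear_cinner_left]
        bounded_linear.continuous_on[OF bounded_linear_cinner_right] continuous_intros)
  then have "closed (bop \<inter> (\<Inter>x. \<Inter>y. {Y :: 'a \<Rightarrow>\<^sub>L 'a.
      cinner (blinfun_apply Y x) y = cinner x (blinfun_apply Y y)}))"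
    by (intro closed_INT closed_Int closed_bop ballI)
  also have "\<dots> = {Y \<in> bop. adj Y = Y}"
  proof safe
    fix Y :: "'a \<Rightarrow>\<^sub>L 'a"
    assume "Y \<in> bop" "Y \<in> (\<Inter>x. \<Inter>y. {Y. cinner (blinfun_apply Y x) y = cinner x (blinfun_apply Y y)})"
    then show "adj Y = Y"
      by (intro adj_eqI) auto
  next
    fix Y :: "'a \<Rightarrow>\<^sub>L 'a" and x y
    assume "Y \<in> bop" "adj Y = Y"
    then show "cinner (blinfun_apply Y x) y = cinner x (blinfun_apply Y y)"
      using cinner_adj_right[of Y x y] by metis
  qed
  finally show ?thesis .
qed

text \<open>The fixed point \<open>Y\<close> satisfies \<open>(1 - Y)\<^sup>2 = 1 - B\<close>, so \<open>1 - Y\<close> is a square root of \<open>1 - B\<close>.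
  The map \<open>Y \<mapsto> (B + Y\<^sup>2) / 2\<close> preserves the ball of radius \<open>b = norm B\<close>, because
  \<open>(b + b\<^sup>2) / 2 \<le> b\<close>, and contracts it by the factor \<open>b\<close>.\<close>

lemma square_root_fixed_point:
  fixes B :: "'a::chilbert_space \<Rightarrow>\<^sub>L 'a"
  assumes B: "B \<in> bop" "adj B = B" "norm B < 1"
  obtains Y where "Y \<in> bop" "adj Y = Y" "norm Y \<le> norm B" "2 *\<^sub>R Y = B + (Y o\<^sub>L Y)"
proof -
  define b where "b = norm B"
  define S where "S = {Y \<in> bop. adj Y = (Y :: 'a \<Rightarrow>\<^sub>L 'a)} \<inter> cball 0 b"
  define f where "f Y = (1 / 2) *\<^sub>R (B + (Y o\<^sub>L Y))" for Y :: "'a \<Rightarrow>\<^sub>L 'a"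
  have b: "0 \<le> b" "b < 1"
    using B by (auto simp: b_def)
  have "\<exists>!Y. Y \<in> S \<and> f Y = Y"
  proof (rule Banach_fix)
    show "complete S"
      unfolding S_def complete_eq_closed by (intro closed_Int closed_selfadjoint closed_cball)
    have "0 \<in> S"
      using b by (simp add: S_def adj_eqI)
    then show "S \<noteq> {}"
      by blast
    show "f ` S \<subseteq> S"
    proof safe
      fix Y assume "Y \<in> S"
      then have Y: "Y \<in> bop" "adj Y = Y" "norm Y \<le> b"
        by (auto simp: S_def)
      have bop: "B + (Y o\<^sub>L Y) \<in> bop"
        by (intro bop_add bop_compose B Y)
      have f: "f Y = op_scaleC (1 / 2) (B + (Y o\<^sub>L Y))"
        unfolding f_def by (intro blinfun_eqI) (simp add: scaleR_scaleC blinfun.scaleR_left)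
      have "adj (f Y) = f Y"
        unfolding f using bop B Y by (simp add: adj_scaleC adj_add bop_compose adj_compose)
      moreover have "norm (f Y) \<le> b"
      proof -
        have "norm (Y o\<^sub>L Y) \<le> norm Y * norm Y"
          by (rule norm_blinfun_compose)
        also have "\<dots> \<le> b * 1"
          using Y b by (intro mult_mono) auto
        finally show ?thesis
          using norm_triangle_ineq[of B "Y o\<^sub>L Y"] by (simp add: f_def b_def)
      qed
      ultimately show "f Y \<in> S"
        using bop by (simp add: S_def f bop_scaleC)
    qed
    show "dist (f X) (f Y) \<le> b * dist X Y" if XY: "X \<in> S" "Y \<in> S" for X Y
    proof -
      have eq: "f X - f Y = (1 / 2) *\<^sub>R ((X o\<^sub>L (X - Y)) + ((X - Y) o\<^sub>L Y))"
        unfolding f_def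
        by (intro blinfun_eqI) (simp add: blinfun.add_left blinfun.diff_left blinfun.diff_right
            blinfun.scaleR_left algebra_simps)
      have "norm (X o\<^sub>L (X - Y)) \<le> b * norm (X - Y)"
        using XY by (intro order_trans[OF norm_blinfun_compose] mult_right_mono) (auto simp: S_def)
      moreover have "norm ((X - Y) o\<^sub>L Y) \<le> norm (X - Y) * b"
        using XY by (intro order_trans[OF norm_blinfun_compose] mult_left_mono) (auto simp: S_def)
      ultimately show "dist (f X) (f Y) \<le> b * dist X Y"
        using norm_triangle_ineq[of "X o\<^sub>L (X - Y)" "(X - Y) o\<^sub>L Y"]
        unfolding dist_norm eq by (simp add: mult.commute)
    qed
  qed (use b in auto)
  then obtain Y where Y: "Y \<in> S" "f Y = Y"
    by blast
  then have "2 *\<^sub>R Y = 2 *\<^sub>R f Y"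
    by simp
  then have "2 *\<^sub>R Y = B + (Y o\<^sub>L Y)"
    by (simp add: f_def)
  then show thesis
    using Y by (intro that) (auto simp: S_def b_def)
qed

text \<open>The Neumann series, summed as the fixed point of \<open>Z \<mapsto> 1 + Y Z\<close>.\<close>

lemma invertible_op_id_minus:
  fixes Y :: "'a::chilbert_space \<Rightarrow>\<^sub>L 'a"
  assumes "norm Y < 1"
  shows "invertible_op (id_blinfun - Y)"
proof -
  have "\<exists>!Z. id_blinfun + (Y o\<^sub>L Z) = Z"
  proof (rule banach_fix_type[of "norm Y"])
    show "\<forall>X Z. dist (id_blinfun + (Y o\<^sub>L X)) (id_blinfun + (Y o\<^sub>L Z)) \<le> norm Y * dist X Z"
    proof safe
      fix X Z :: "'a \<Rightarrow>\<^sub>L 'a"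
      have "(Y o\<^sub>L X) - (Y o\<^sub>L Z) = (Y o\<^sub>L (X - Z))"
        by (intro blinfun_eqI) (simp add: blinfun.diff_left blinfun.diff_right)
      then show "dist (id_blinfun + (Y o\<^sub>L X)) (id_blinfun + (Y o\<^sub>L Z)) \<le> norm Y * dist X Z"
        using norm_blinfun_compose[of Y "X - Z"] by (simp add: dist_norm)
    qed
  qed (use assms in auto)
  then obtain Z where Z: "id_blinfun + (Y o\<^sub>L Z) = Z"
    by blast
  have "\<exists>!W. id_blinfun + (W o\<^sub>L Y) = W"
  proof (rule banach_fix_type[of "norm Y"])
    show "\<forall>X Z. dist (id_blinfun + (X o\<^sub>L Y)) (id_blinfun + (Z o\<^sub>L Y)) \<le> norm Y * dist X Z"
    proof safe
      fix X Z :: "'a \<Rightarrow>\<^sub>L 'a"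
      have "(X o\<^sub>L Y) - (Z o\<^sub>L Y) = ((X - Z) o\<^sub>L Y)"
        by (intro blinfun_eqI) (simp add: blinfun.diff_left blinfun.diff_right)
      then show "dist (id_blinfun + (X o\<^sub>L Y)) (id_blinfun + (Z o\<^sub>L Y)) \<le> norm Y * dist X Z"
        using norm_blinfun_compose[of "X - Z" Y] by (simp add: dist_norm mult.commute)
    qed
  qed (use assms in auto)
  then obtain W where W: "id_blinfun + (W o\<^sub>L Y) = W"
    by blast
  have r: "blinfun_apply Z x - blinfun_apply Y (blinfun_apply Z x) = x" for x
    by (subst (1) Z[symmetric]) (simp add: blinfun.add_left)
  have l: "blinfun_apply W x - blinfun_apply W (blinfun_apply Y x) = x" for x
    by (subst (1) W[symmetric]) (simp add: blinfun.add_left)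
  have "blinfun_apply W x = blinfun_apply Z x" for x
    using l[of "blinfun_apply Z x"] r[of x] by (metis blinfun.diff_right)
  then have "W = Z"
    by (rule blinfun_eqI)
  show ?thesis
    unfolding invertible_op_def
    by (rule exI[of _ Z], intro conjI blinfun_eqI)
       (use r l \<open>W = Z\<close> in \<open>simp_all add: blinfun.diff_left blinfun.diff_right\<close>)
qed

text \<open>With \<open>P = E E\<^sup>*\<close>, the lower bound coming from the right inverse \<open>R\<close> makes \<open>B = 1 - P / c\<close> a
  strict contraction for large \<open>c\<close>, and \<open>Q = sqrt c (1 - Y)\<close> is the invertible square root of
  \<open>P\<close>.\<close>

lemma polar_decomposition_adj:
  fixes E :: "'a::chilbert_space \<Rightarrow>\<^sub>L 'b::chilbert_space"
  assumes E: "E \<in> bop"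
    and R: "\<And>x. blinfun_apply E (R x) = x" "\<And>x. norm (R x) \<le> C * norm x"
  shows "\<exists>V. isometry_op V \<and> (\<exists>Q. positive_op Q \<and> invertible_op Q \<and> adj E = V o\<^sub>L Q)"
proof -
  define D where "D = \<bar>C\<bar> + 1"
  define \<delta> where "\<delta> = 1 / D\<^sup>2"
  define c where "c = (norm E)\<^sup>2 + \<delta> + 1"
  define P where "P = E o\<^sub>L adj E"
  define B where "B = id_blinfun - op_scaleC (of_real (1 / c)) P"
  have D: "D > 0"
    by (simp add: D_def add_nonneg_pos)
  then have \<delta>: "\<delta> > 0"
    by (simp add: \<delta>_def)
  then have c: "c > 0" "\<delta> < c" "(norm E)\<^sup>2 \<le> c"
    by (auto simp: c_def intro!: add_nonneg_pos add_nonneg_nonneg)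
  have P: "P \<in> bop" "adj P = P"
    using E by (auto simp: P_def bop_compose adj_compose adj_adj)
  have B: "B \<in> bop" "adj B = B"
    unfolding B_def using P by (auto simp: bop_diff bop_scaleC adj_diff adj_scaleC adj_eqI)
  have Pinner: "cinner (blinfun_apply P x) y = cinner (blinfun_apply (adj E) x) (blinfun_apply (adj E) y)" for x y
    using cinner_adj_right[OF E] by (simp add: P_def)
  have low: "\<delta> * (norm x)\<^sup>2 \<le> (norm (blinfun_apply (adj E) x))\<^sup>2" for x
  proof -
    have "(norm x)\<^sup>2 = Re (cinner (R x) (blinfun_apply (adj E) x))"
      using cinner_adj_right[OF E, of "R x" x] R(1) by (simp add: Re_cinner_self[symmetric])
    also have "\<dots> \<le> norm (R x) * norm (blinfun_apply (adj E) x)"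
      using complex_Re_le_cmod cmod_cinner_le order_trans by blast
    also have "\<dots> \<le> D * norm x * norm (blinfun_apply (adj E) x)"
      using order_trans[OF R(2)[of x] mult_right_mono[of C D "norm x"]]
      by (intro mult_right_mono) (auto simp: D_def)
    finally have "norm x \<le> D * norm (blinfun_apply (adj E) x)"
      using D by (cases "x = 0") (auto simp: power2_eq_square)
    then have "(norm x)\<^sup>2 \<le> (D * norm (blinfun_apply (adj E) x))\<^sup>2"
      by (intro power_mono) auto
    then show ?thesis
      using D by (simp add: \<delta>_def power_mult_distrib field_simps)
  qed
  have "norm B \<le> sqrt (1 - \<delta> / c)"
  proof (rule norm_blinfun_bound)
    fix x
    let ?s = "(norm (blinfun_apply (adj E) x))\<^sup>2"
    have "(norm (blinfun_apply P x))\<^sup>2 \<le> (norm E * norm (blinfun_apply (adj E) x))\<^sup>2"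
      unfolding P_def by (intro power_mono) (auto intro: norm_blinfun)
    also have "\<dots> \<le> c * ?s"
      unfolding power_mult_distrib using c by (intro mult_right_mono) auto
    finally have PP: "(norm (blinfun_apply P x))\<^sup>2 / c\<^sup>2 \<le> ?s / c"
      using c by (simp add: field_simps power2_eq_square)
    have "Re (cinner x (blinfun_apply P x)) = ?s"
      using Pinner[of x x] cinner_commute[of x "blinfun_apply P x"] by (simp add: Re_cinner_self)
    then have "(norm (blinfun_apply B x))\<^sup>2 = (norm x)\<^sup>2 - 2 * ?s / c + (norm (blinfun_apply P x))\<^sup>2 / c\<^sup>2"
      using c unfolding B_def blinfun.diff_left norm_diff_square
      by (simp add: cinner_simps norm_divide power_divide)
    also have "\<dots> \<le> (norm x)\<^sup>2 - ?s / c"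
      using PP by simp
    also have "\<dots> \<le> (1 - \<delta> / c) * (norm x)\<^sup>2"
      using divide_right_mono[OF low[of x] less_imp_le[OF c(1)]] by (simp add: algebra_simps)
    also have "\<dots> = (sqrt (1 - \<delta> / c) * norm x)\<^sup>2"
      using c by (simp add: power_mult_distrib)
    finally show "norm (blinfun_apply B x) \<le> sqrt (1 - \<delta> / c) * norm x"
      by (rule power2_le_imp_le) (use c in auto)
  qed (use c in auto)
  also have "\<dots> < 1"
    using c \<delta> by simp
  finally have nB: "norm B < 1" .
  obtain Y where Y: "Y \<in> bop" "adj Y = Y" "norm Y \<le> norm B" "2 *\<^sub>R Y = B + (Y o\<^sub>L Y)"
    using square_root_fixed_point[OF B nB] .
  obtain Z where Z: "(id_blinfun - Y) o\<^sub>L Z = id_blinfun" "Z o\<^sub>L (id_blinfun - Y) = id_blinfun"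
    using invertible_op_id_minus[of Y] Y(3) nB unfolding invertible_op_def by auto
  define Q where "Q = sqrt c *\<^sub>R (id_blinfun - Y)"
  define Q' where "Q' = (1 / sqrt c) *\<^sub>R Z"
  have Zx: "blinfun_apply Z x - blinfun_apply Y (blinfun_apply Z x) = x"
    "blinfun_apply Z x - blinfun_apply Z (blinfun_apply Y x) = x" for x
    using Z[THEN arg_cong, of "\<lambda>T. blinfun_apply T x"] by (simp_all add: blinfun.diff_left blinfun.diff_right)
  have QQ': "Q o\<^sub>L Q' = id_blinfun" "Q' o\<^sub>L Q = id_blinfun"
    using c Zx by (auto simp: Q_def Q'_def blinfun.scaleR_left blinfun.scaleR_right blinfun.diff_left
        blinfun.diff_right scaleR_right_diff_distrib intro!: blinfun_eqI)
  have QQ'x: "blinfun_apply Q (blinfun_apply Q' x) = x" "blinfun_apply Q' (blinfun_apply Q x) = x" for x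
    using QQ'[THEN arg_cong, of "\<lambda>T. blinfun_apply T x"] by simp_all
  have Q: "Q \<in> bop"
    unfolding Q_def by (intro bop_scaleR bop_diff Y bop_id)
  have Q'bop: "Q' \<in> bop"
    unfolding bop_def
  proof safe
    fix a x
    have "blinfun_apply Q' (a *\<^sub>C x) = blinfun_apply Q' (blinfun_apply Q (a *\<^sub>C blinfun_apply Q' x))"
      by (simp add: bopD[OF Q] QQ'x)
    then show "blinfun_apply Q' (a *\<^sub>C x) = a *\<^sub>C blinfun_apply Q' x"
      by (simp add: QQ'x)
  qed
  have Qsym: "cinner (blinfun_apply Q x) y = cinner x (blinfun_apply Q y)" for x y
    using cinner_adj_right[OF Y(1), of x y] Y(2)
    by (simp add: Q_def blinfun.scaleR_left blinfun.diff_left scaleR_scaleC cinner_simps)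
  have QQ: "blinfun_apply Q (blinfun_apply Q x) = blinfun_apply P x" for x
  proof -
    have "2 *\<^sub>R blinfun_apply Y x = x - (1 / c) *\<^sub>R blinfun_apply P x + blinfun_apply Y (blinfun_apply Y x)"
      using Y(4)[THEN arg_cong, of "\<lambda>T. blinfun_apply T x"]
      by (simp add: B_def blinfun.scaleR_left blinfun.add_left blinfun.diff_left scaleR_scaleC)
    then have "(1 / c) *\<^sub>R blinfun_apply P x
        = x - 2 *\<^sub>R blinfun_apply Y x + blinfun_apply Y (blinfun_apply Y x)"
      by (simp add: algebra_simps)
    then have "c *\<^sub>R ((1 / c) *\<^sub>R blinfun_apply P x)
        = c *\<^sub>R (x - 2 *\<^sub>R blinfun_apply Y x + blinfun_apply Y (blinfun_apply Y x))"
      by simp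
    then have "blinfun_apply P x
        = c *\<^sub>R (x - 2 *\<^sub>R blinfun_apply Y x + blinfun_apply Y (blinfun_apply Y x))"
      using c by simp
    moreover have "blinfun_apply Q (blinfun_apply Q x)
        = (sqrt c * sqrt c) *\<^sub>R (x - 2 *\<^sub>R blinfun_apply Y x + blinfun_apply Y (blinfun_apply Y x))"
      by (simp add: Q_def blinfun.scaleR_left blinfun.scaleR_right blinfun.diff_left
          blinfun.diff_right algebra_simps scaleR_2)
    ultimately show ?thesis
      using c by simp
  qed
  have pos: "positive_op Q"
    unfolding positive_op_def
  proof (intro conjI allI)
    fix x
    show "Im (cinner (blinfun_apply Q x) x) = 0"
      using Qsym[of x x] cinner_commute[of "blinfun_apply Q x" x]
      by (metis complex_cnj_cancel_iff complex_is_Real_iff Reals_cnj_iff)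
    have "Re (cinner (blinfun_apply Y x) x) \<le> norm (blinfun_apply Y x) * norm x"
      using complex_Re_le_cmod cmod_cinner_le order_trans by blast
    also have "\<dots> \<le> norm Y * norm x * norm x"
      by (intro mult_right_mono norm_blinfun norm_ge_zero)
    also have "\<dots> \<le> 1 * norm x * norm x"
      using Y(3) nB by (intro mult_right_mono) auto
    finally show "0 \<le> Re (cinner (blinfun_apply Q x) x)"
      using c by (simp add: Q_def blinfun.scaleR_left blinfun.diff_left scaleR_scaleC cinner_simps
          Re_cinner_self power2_eq_square)
  qed (rule Q)
  define V where "V = adj E o\<^sub>L Q'"
  have "norm (blinfun_apply V x) = norm x" for x
  proof -
    have "cinner (blinfun_apply V x) (blinfun_apply V x) = cinner x x"
      using Pinner[of "blinfun_apply Q' x" "blinfun_apply Q' x"]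
      by (simp add: V_def QQ[symmetric] QQ'x Qsym)
    then have "(norm (blinfun_apply V x))\<^sup>2 = (norm x)\<^sup>2"
      by (metis Re_cinner_self)
    then show ?thesis
      by simp
  qed
  then have "isometry_op V"
    using E Q'bop by (simp add: isometry_op_def V_def bop_compose)
  moreover have "adj E = V o\<^sub>L Q"
    by (intro blinfun_eqI) (simp add: V_def QQ'x)
  moreover have "invertible_op Q"
    using QQ' by (auto simp: invertible_op_def)
  ultimately show ?thesis
    using pos by blast
qed

section \<open>Extension from a dense subspace\<close>

lemma bounded_extension_from_dense:
  fixes g :: "'a::chilbert_space \<Rightarrow> 'b::chilbert_space"
  assumes dense: "closure S = UNIV"
    and S: "\<And>x y. x \<in> S \<Longrightarrow> y \<in> S \<Longrightarrow> x + y \<in> S" "\<And>c x. x \<in> S \<Longrightarrow> c *\<^sub>C x \<in> S"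
    and g: "\<And>x y. x \<in> S \<Longrightarrow> y \<in> S \<Longrightarrow> g (x + y) = g x + g y"
      "\<And>c x. x \<in> S \<Longrightarrow> g (c *\<^sub>C x) = c *\<^sub>C g x"
    and bound: "\<And>x. x \<in> S \<Longrightarrow> norm (g x) \<le> C * norm x"
    and C: "0 \<le> C"
  shows "\<exists>T\<in>bop. (\<forall>x\<in>S. blinfun_apply T x = g x) \<and> norm T \<le> C"
proof -
  have "(C + 1)-lipschitz_on S g"
  proof (rule lipschitz_onI)
    fix x y assume xy: "x \<in> S" "y \<in> S"
    have "x - y \<in> S" "g (x - y) = g x - g y"
      using S(1)[of x "(- 1) *\<^sub>C y"] S(2)[of y "- 1"] g(1)[of x "(- 1) *\<^sub>C y"] g(2)[of y "- 1"] xy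
      by (simp_all add: scaleC_minus_left)
    then have "dist (g x) (g y) \<le> C * dist x y"
      using bound[of "x - y"] by (simp add: dist_norm)
    then show "dist (g x) (g y) \<le> (C + 1) * dist x y"
      using zero_le_dist[of x y] unfolding distrib_right by linarith
  qed (use C in simp)
  then have "uniformly_continuous_on S g"
    by (rule lipschitz_on_uniformly_continuous)
  then obtain h where h: "uniformly_continuous_on (closure S) h" "\<And>x. x \<in> S \<Longrightarrow> g x = h x"
    using uniformly_continuous_on_extension_on_closure by metis
  have cont: "continuous_on UNIV h"
    using uniformly_continuous_imp_continuous[OF h(1)] dense by simp
  have limh: "(\<lambda>n. h (X n)) \<longlonglongrightarrow> h x" if "X \<longlonglongrightarrow> x" for X x
    using continuous_on_tendsto_compose[OF cont that] by simp
  have "\<exists>X. (\<forall>n::nat. X n \<in> S) \<and> X \<longlonglongrightarrow> x" for x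
    using closure_sequential[of x S] dense by simp
  then obtain X where X: "\<And>x n. X x n \<in> S" "\<And>x. X x \<longlonglongrightarrow> x"
    by metis
  have add: "h (x + y) = h x + h y" for x y
  proof (rule LIMSEQ_unique)
    show "(\<lambda>n. h (X x n + X y n)) \<longlonglongrightarrow> h (x + y)"
      by (intro limh tendsto_add X)
    have "h (X x n + X y n) = h (X x n) + h (X y n)" for n
      using h(2) g(1) S(1) X(1) by metis
    then show "(\<lambda>n. h (X x n + X y n)) \<longlonglongrightarrow> h x + h y"
      by (simp add: tendsto_add limh X)
  qed
  have scale: "h (c *\<^sub>C x) = c *\<^sub>C h x" for c x
  proof (rule LIMSEQ_unique)
    show "(\<lambda>n. h (c *\<^sub>C X x n)) \<longlonglongrightarrow> h (c *\<^sub>C x)"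
      by (intro limh bounded_linear.tendsto[OF bounded_linear_scaleC] X)
    have "h (c *\<^sub>C X x n) = c *\<^sub>C h (X x n)" for n
      using h(2) g(2) S(2) X(1) by metis
    then show "(\<lambda>n. h (c *\<^sub>C X x n)) \<longlonglongrightarrow> c *\<^sub>C h x"
      by (simp add: bounded_linear.tendsto[OF bounded_linear_scaleC] limh X)
  qed
  have hbound: "norm (h x) \<le> C * norm x" for x
  proof (rule LIMSEQ_le)
    show "(\<lambda>n. norm (h (X x n))) \<longlonglongrightarrow> norm (h x)" "(\<lambda>n. C * norm (X x n)) \<longlonglongrightarrow> C * norm x"
      by (intro tendsto_intros limh X)+
    show "\<exists>N. \<forall>n\<ge>N. norm (h (X x n)) \<le> C * norm (X x n)"
      using bound X(1) h(2) by metis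
  qed
  have "bounded_linear h"
    using add scale hbound
    by (intro bounded_linear_intro[where K = C]) (simp_all add: scaleR_scaleC mult.commute)
  then have ap: "blinfun_apply (Blinfun h) = h"
    by (rule bounded_linear_Blinfun_apply)
  show ?thesis
    by (rule bexI[of _ "Blinfun h"])
       (use scale h(2) hbound C in \<open>auto simp: bop_def ap intro: norm_blinfun_bound\<close>)
qed

lemma blinfun_eqI_dense:
  fixes S T :: "'a::real_normed_vector \<Rightarrow>\<^sub>L 'b::real_normed_vector"
  assumes "closure D = UNIV" "\<And>x. x \<in> D \<Longrightarrow> blinfun_apply S x = blinfun_apply T x"
  shows "S = T"
proof -
  have "closed {x. blinfun_apply S x = blinfun_apply T x}"
    by (intro closed_Collect_eq continuous_intros)
  then have "closure D \<subseteq> {x. blinfun_apply S x = blinfun_apply T x}"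
    using assms(2) by (intro closure_minimal) auto
  then show ?thesis
    using assms(1) by (intro blinfun_eqI) auto
qed

section \<open>The function algebra and its characters\<close>

lemma holomorphic_Cn_const: "holomorphic_Cn (\<lambda>_. c) U"
  unfolding holomorphic_Cn_def by (intro ballI exI[of _ "\<lambda>_. 0"]) simp

lemma holomorphic_Cn_add:
  assumes "holomorphic_Cn f U" "holomorphic_Cn g U"
  shows "holomorphic_Cn (\<lambda>z. f z + g z) U"
  unfolding holomorphic_Cn_def
proof
  fix z assume "z \<in> U"
  then obtain D D' where
    "(f has_derivative D) (at z)" "\<forall>c v. D (c *\<^sub>C v) = c * D v"
    "(g has_derivative D') (at z)" "\<forall>c v. D' (c *\<^sub>C v) = c * D' v"
    using assms unfolding holomorphic_Cn_def by metis
  then show "\<exists>D. ((\<lambda>z. f z + g z) has_derivative D) (at z) \<and> (\<forall>c v. D (c *\<^sub>C v) = c * D v)"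
    by (intro exI[of _ "\<lambda>v. D v + D' v"] conjI has_derivative_add) (auto simp: algebra_simps)
qed

lemma holomorphic_Cn_mult:
  assumes "holomorphic_Cn f U" "holomorphic_Cn g U"
  shows "holomorphic_Cn (\<lambda>z. f z * g z) U"
  unfolding holomorphic_Cn_def
proof
  fix z assume "z \<in> U"
  then obtain D D' where
    "(f has_derivative D) (at z)" "\<forall>c v. D (c *\<^sub>C v) = c * D v"
    "(g has_derivative D') (at z)" "\<forall>c v. D' (c *\<^sub>C v) = c * D' v"
    using assms unfolding holomorphic_Cn_def by metis
  then show "\<exists>D. ((\<lambda>z. f z * g z) has_derivative D) (at z) \<and> (\<forall>c v. D (c *\<^sub>C v) = c * D v)"
    by (intro exI[of _ "\<lambda>v. f z * D' v + D v * g z"] conjI has_derivative_mult)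
       (auto simp: algebra_simps)
qed

lemma holomorphic_Cn_subset: "holomorphic_Cn f U \<Longrightarrow> V \<subseteq> U \<Longrightarrow> holomorphic_Cn f V"
  unfolding holomorphic_Cn_def by blast

lemma holomorphic_Cn_continuous_on: "holomorphic_Cn f U \<Longrightarrow> continuous_on U f"
  unfolding holomorphic_Cn_def
  by (meson continuous_at_imp_continuous_on has_derivative_continuous)

lemma fun_algE:
  assumes "f \<in> fun_alg \<Omega>" "e > 0"
  obtains g U where "open U" "closure \<Omega> \<subseteq> U" "holomorphic_Cn g U"
    "\<And>z. z \<in> closure \<Omega> \<Longrightarrow> cmod (f z - g z) < e"
proof -
  have "\<exists>g U. open U \<and> closure \<Omega> \<subseteq> U \<and> holomorphic_Cn g U \<and>
      (\<forall>z\<in>closure \<Omega>. cmod (f z - g z) < e)"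
    using assms by (simp add: fun_alg_def)
  then show thesis
    using that by metis
qed

lemma fun_alg_zero_outside: "f \<in> fun_alg \<Omega> \<Longrightarrow> z \<notin> closure \<Omega> \<Longrightarrow> f z = 0"
  unfolding fun_alg_def by blast

lemma fun_algI:
  assumes "\<And>z. z \<notin> closure \<Omega> \<Longrightarrow> f z = 0"
    and "\<And>e. e > 0 \<Longrightarrow> \<exists>g U. open U \<and> closure \<Omega> \<subseteq> U \<and> holomorphic_Cn g U \<and>
      (\<forall>z\<in>closure \<Omega>. cmod (f z - g z) < e)"
  shows "f \<in> fun_alg \<Omega>"
  unfolding fun_alg_def using assms by blast

lemma fun_alg_continuous_on:
  assumes "f \<in> fun_alg \<Omega>"
  shows "continuous_on (closure \<Omega>) f"
proof -
  have "\<exists>g. continuous_on (closure \<Omega>) g \<and> (\<forall>z\<in>closure \<Omega>. cmod (f z - g z) < e)" if "e > 0" for e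
    using fun_algE[OF assms that] holomorphic_Cn_continuous_on continuous_on_subset by metis
  then obtain G where G: "\<And>e. e > 0 \<Longrightarrow> continuous_on (closure \<Omega>) (G e)"
    "\<And>e z. e > 0 \<Longrightarrow> z \<in> closure \<Omega> \<Longrightarrow> cmod (f z - G e z) < e"
    by metis
  have "\<forall>\<^sub>F e in at_right (0::real). e > 0"
    by (simp add: eventually_at_right_less)
  show ?thesis
  proof (rule uniform_limit_theorem[where F = "at_right (0::real)" and f = G])
    show "\<forall>\<^sub>F e in at_right 0. continuous_on (closure \<Omega>) (G e)"
      using \<open>\<forall>\<^sub>F e in at_right (0::real). e > 0\<close> by eventually_elim (rule G)
    show "uniform_limit (closure \<Omega>) G f (at_right 0)"
    proof (rule uniform_limitI)
      fix e :: real assume "e > 0"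
      then have "\<forall>\<^sub>F d in at_right (0::real). d < e \<and> 0 < d"
        by (auto simp: eventually_at_right)
      then show "\<forall>\<^sub>F d in at_right 0. \<forall>z\<in>closure \<Omega>. dist (G d z) (f z) < e"
        by eventually_elim (use G(2) in \<open>force simp: dist_norm norm_minus_commute\<close>)
    qed
  qed simp
qed

lemma fun_alg_indicator: "indicator (closure \<Omega>) \<in> fun_alg \<Omega>"
  by (rule fun_algI) (auto intro!: exI[of _ "\<lambda>_. 1"] exI[of _ UNIV] holomorphic_Cn_const)

lemma fun_alg_add:
  assumes "f \<in> fun_alg \<Omega>" "g \<in> fun_alg \<Omega>"
  shows "(\<lambda>z. f z + g z) \<in> fun_alg \<Omega>"
proof (rule fun_algI)
  fix e :: real assume "e > 0"
  then have e2: "e / 2 > 0"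
    by simp
  obtain f' U where f': "open U" "closure \<Omega> \<subseteq> U" "holomorphic_Cn f' U"
    "\<And>z. z \<in> closure \<Omega> \<Longrightarrow> cmod (f z - f' z) < e / 2"
    by (rule fun_algE[OF assms(1) e2]) (rule that)
  obtain g' U' where g': "open U'" "closure \<Omega> \<subseteq> U'" "holomorphic_Cn g' U'"
    "\<And>z. z \<in> closure \<Omega> \<Longrightarrow> cmod (g z - g' z) < e / 2"
    by (rule fun_algE[OF assms(2) e2]) (rule that)
  have "cmod (f z + g z - (f' z + g' z)) < e" if "z \<in> closure \<Omega>" for z
    using norm_triangle_ineq[of "f z - f' z" "g z - g' z"] f'(4)[OF that] g'(4)[OF that]
    by (simp add: algebra_simps)
  then show "\<exists>h U. open U \<and> closure \<Omega> \<subseteq> U \<and> holomorphic_Cn h U \<and>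
      (\<forall>z\<in>closure \<Omega>. cmod (f z + g z - h z) < e)"
    using f' g'
    by (intro exI[of _ "\<lambda>z. f' z + g' z"] exI[of _ "U \<inter> U'"])
       (auto intro!: holomorphic_Cn_add intro: holomorphic_Cn_subset)
qed (simp add: fun_alg_zero_outside[OF assms(1)] fun_alg_zero_outside[OF assms(2)])

lemma fun_alg_bound:
  assumes "bounded \<Omega>" "f \<in> fun_alg \<Omega>"
  obtains B where "B > 0" "\<And>z. z \<in> closure \<Omega> \<Longrightarrow> cmod (f z) \<le> B"
proof -
  have "compact (f ` closure \<Omega>)"
    using assms by (intro compact_continuous_image fun_alg_continuous_on) simp_all
  then show thesis
    using compact_imp_bounded bounded_pos[of "f ` closure \<Omega>"] that by auto
qed

lemma fun_alg_mult:
  assumes bdd: "bounded \<Omega>" and f: "f \<in> fun_alg \<Omega>" and g: "g \<in> fun_alg \<Omega>"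
  shows "(\<lambda>z. f z * g z) \<in> fun_alg \<Omega>"
proof (rule fun_algI)
  fix e :: real assume e: "e > 0"
  obtain B where B: "B > 0" "\<And>z. z \<in> closure \<Omega> \<Longrightarrow> cmod (f z) \<le> B"
    by (rule fun_alg_bound[OF bdd f]) (rule that)
  obtain C where C: "C > 0" "\<And>z. z \<in> closure \<Omega> \<Longrightarrow> cmod (g z) \<le> C"
    by (rule fun_alg_bound[OF bdd g]) (rule that)
  define d where "d = min 1 (e / (B + C + 1))"
  have d: "d > 0" "d \<le> 1"
    using e B(1) C(1) by (auto simp: d_def)
  have "(B + C + 1) * d \<le> (B + C + 1) * (e / (B + C + 1))"
    using B(1) C(1) by (intro mult_left_mono) (auto simp: d_def)
  also have "\<dots> = e"
    using B(1) C(1) by simp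
  finally have de: "(B + C + 1) * d \<le> e" .
  obtain f' U where f': "open U" "closure \<Omega> \<subseteq> U" "holomorphic_Cn f' U"
    "\<And>z. z \<in> closure \<Omega> \<Longrightarrow> cmod (f z - f' z) < d"
    by (rule fun_algE[OF f d(1)]) (rule that)
  obtain g' U' where g': "open U'" "closure \<Omega> \<subseteq> U'" "holomorphic_Cn g' U'"
    "\<And>z. z \<in> closure \<Omega> \<Longrightarrow> cmod (g z - g' z) < d"
    by (rule fun_algE[OF g d(1)]) (rule that)
  have "cmod (f z * g z - f' z * g' z) < e" if z: "z \<in> closure \<Omega>" for z
  proof -
    have g'z: "cmod (g' z) \<le> C + 1"
      using norm_triangle_ineq2[of "g' z" "g z"] g'(4)[OF z] C(2)[OF z] d(2)
      by (simp add: norm_minus_commute)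
    have "f z * g z - f' z * g' z = f z * (g z - g' z) + (f z - f' z) * g' z"
      by (simp add: algebra_simps)
    then have "cmod (f z * g z - f' z * g' z) \<le> cmod (f z) * cmod (g z - g' z) + cmod (f z - f' z) * cmod (g' z)"
      by (metis norm_mult norm_triangle_ineq)
    also have "\<dots> \<le> B * cmod (g z - g' z) + cmod (f z - f' z) * (C + 1)"
      using B(1) B(2)[OF z] g'z by (intro add_mono mult_mono) auto
    also have "\<dots> < B * d + d * (C + 1)"
      using g'(4)[OF z] f'(4)[OF z] B(1) C(1)
      by (intro add_strict_mono mult_strict_left_mono mult_strict_right_mono) auto
    also have "\<dots> \<le> e"
      using de by (simp add: algebra_simps)
    finally show ?thesis .
  qed
  then show "\<exists>h U. open U \<and> closure \<Omega> \<subseteq> U \<and> holomorphic_Cn h U \<and>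
      (\<forall>z\<in>closure \<Omega>. cmod (f z * g z - h z) < e)"
    using f' g'
    by (intro exI[of _ "\<lambda>z. f' z * g' z"] exI[of _ "U \<inter> U'"])
       (auto intro!: holomorphic_Cn_mult intro: holomorphic_Cn_subset)
qed (simp add: fun_alg_zero_outside[OF f])

lemma fun_alg_scale:
  assumes "bounded \<Omega>" "f \<in> fun_alg \<Omega>"
  shows "(\<lambda>z. c * f z) \<in> fun_alg \<Omega>"
proof -
  have "(\<lambda>z. c * indicator (closure \<Omega>) z) \<in> fun_alg \<Omega>"
    by (rule fun_algI) (auto intro!: exI[of _ "\<lambda>_. c"] exI[of _ UNIV] holomorphic_Cn_const)
  from fun_alg_mult[OF assms(1) this assms(2)]
  have "(\<lambda>z. c * indicator (closure \<Omega>) z * f z) \<in> fun_alg \<Omega>" .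
  also have "(\<lambda>z. c * indicator (closure \<Omega>) z * f z) = (\<lambda>z. c * f z)"
    using fun_alg_zero_outside[OF assms(2)] by (auto simp: indicator_def fun_eq_iff)
  finally show ?thesis .
qed

lemma fun_alg_shift:
  assumes "bounded \<Omega>" "f \<in> fun_alg \<Omega>"
  shows "(\<lambda>z. f z + c * indicator (closure \<Omega>) z) \<in> fun_alg \<Omega>"
  by (intro fun_alg_add fun_alg_scale fun_alg_indicator assms)

text \<open>The factor \<open>indicator (closure \<Omega>)\<close> gives the unit of the algebra for \<open>N = 0\<close>.\<close>

lemma fun_alg_power:
  assumes "bounded \<Omega>" "f \<in> fun_alg \<Omega>"
  shows "(\<lambda>z. indicator (closure \<Omega>) z * f z ^ N) \<in> fun_alg \<Omega>"
proof (induction N)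
  case (Suc N)
  show ?case
    using fun_alg_mult[OF assms(1) Suc assms(2)] by (simp add: mult_ac)
qed (use fun_alg_indicator in simp)

lemma fun_alg_uniform_limit:
  assumes "\<And>z. z \<notin> closure \<Omega> \<Longrightarrow> f z = 0"
    and approx: "\<And>e. e > 0 \<Longrightarrow> \<exists>g\<in>fun_alg \<Omega>. \<forall>z\<in>closure \<Omega>. cmod (f z - g z) < e"
  shows "f \<in> fun_alg \<Omega>"
proof (rule fun_algI)
  fix e :: real assume "e > 0"
  then have e2: "e / 2 > 0"
    by simp
  obtain g where g: "g \<in> fun_alg \<Omega>" "\<And>z. z \<in> closure \<Omega> \<Longrightarrow> cmod (f z - g z) < e / 2"
    using approx[OF e2] by blast
  obtain h U where h: "open U" "closure \<Omega> \<subseteq> U" "holomorphic_Cn h U"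
    "\<And>z. z \<in> closure \<Omega> \<Longrightarrow> cmod (g z - h z) < e / 2"
    by (rule fun_algE[OF g(1) e2]) (rule that)
  have "cmod (f z - h z) < e" if "z \<in> closure \<Omega>" for z
    using norm_triangle_ineq[of "f z - g z" "g z - h z"] g(2)[OF that] h(4)[OF that] by simp
  then show "\<exists>h U. open U \<and> closure \<Omega> \<subseteq> U \<and> holomorphic_Cn h U \<and>
      (\<forall>z\<in>closure \<Omega>. cmod (f z - h z) < e)"
    using h by blast
qed (use assms(1) in auto)

lemma fun_alg_inverse_one_minus:
  assumes bdd: "bounded \<Omega>" and u: "u \<in> fun_alg \<Omega>"
    and r: "r < 1" "\<And>z. z \<in> closure \<Omega> \<Longrightarrow> cmod (u z) \<le> r" "0 \<le> r"
  shows "(\<lambda>z. indicator (closure \<Omega>) z / (1 - u z)) \<in> fun_alg \<Omega>"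
proof (rule fun_alg_uniform_limit)
  fix e :: real assume e: "e > 0"
  have "(\<lambda>n. r ^ n / (1 - r)) \<longlonglongrightarrow> 0 / (1 - r)"
    using r by (intro tendsto_intros LIMSEQ_realpow_zero) auto
  then have "\<forall>\<^sub>F n in sequentially. r ^ n / (1 - r) < e"
    using e by (auto dest: order_tendstoD(2))
  then obtain n where n: "r ^ n / (1 - r) < e"
    by (auto simp: eventually_sequentially)
  define g where "g z = indicator (closure \<Omega>) z * (\<Sum>k<n. u z ^ k)" for z
  have "(\<lambda>z. indicator (closure \<Omega>) z * (\<Sum>k<l. u z ^ k)) \<in> fun_alg \<Omega>" for l
  proof (induction l)
    case 0
    show ?case
      using fun_alg_scale[OF bdd fun_alg_indicator, of 0] by simp
  next
    case (Suc l)
    show ?case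
      using fun_alg_add[OF Suc fun_alg_power[OF bdd u, of l]] by (simp add: distrib_left)
  qed
  then have "g \<in> fun_alg \<Omega>"
    unfolding g_def .
  moreover have "cmod (indicator (closure \<Omega>) z / (1 - u z) - g z) < e" if z: "z \<in> closure \<Omega>" for z
  proof -
    have ne: "1 - u z \<noteq> 0" and low: "1 - r \<le> cmod (1 - u z)"
      using r(1) r(2)[OF z] norm_triangle_ineq2[of 1 "u z"] by auto
    have "(1 - u z) * (\<Sum>k<n. u z ^ k) = 1 - u z ^ n"
      by (simp add: one_diff_power_eq)
    then have "indicator (closure \<Omega>) z / (1 - u z) - g z = u z ^ n / (1 - u z)"
      using ne z by (simp add: g_def field_simps)
    then have "cmod (indicator (closure \<Omega>) z / (1 - u z) - g z) = cmod (u z) ^ n / cmod (1 - u z)"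
      by (simp add: norm_divide norm_power)
    also have "\<dots> \<le> r ^ n / (1 - r)"
      using low r r(2)[OF z] by (intro frac_le power_mono) auto
    finally show ?thesis
      using n by simp
  qed
  ultimately show "\<exists>g\<in>fun_alg \<Omega>. \<forall>z\<in>closure \<Omega>. cmod (indicator (closure \<Omega>) z / (1 - u z) - g z) < e"
    by blast
qed simp

lemma max_ideal_space_add:
  "\<alpha> \<in> max_ideal_space A \<Longrightarrow> f \<in> A \<Longrightarrow> g \<in> A \<Longrightarrow> \<alpha> (\<lambda>x. f x + g x) = \<alpha> f + \<alpha> g"
  and max_ideal_space_scale:
  "\<alpha> \<in> max_ideal_space A \<Longrightarrow> f \<in> A \<Longrightarrow> \<alpha> (\<lambda>x. c * f x) = c * \<alpha> f"
  and max_ideal_space_mult: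
  "\<alpha> \<in> max_ideal_space A \<Longrightarrow> f \<in> A \<Longrightarrow> g \<in> A \<Longrightarrow> \<alpha> (\<lambda>x. f x * g x) = \<alpha> f * \<alpha> g"
  unfolding max_ideal_space_def by simp_all

lemma max_ideal_space_indicator:
  assumes "\<alpha> \<in> max_ideal_space (fun_alg \<Omega>)"
  shows "\<alpha> (indicator (closure \<Omega>)) = 1"
proof -
  obtain f where f: "f \<in> fun_alg \<Omega>" "\<alpha> f \<noteq> 0"
    using assms unfolding max_ideal_space_def by blast
  have "(\<lambda>z. f z * indicator (closure \<Omega>) z) = f"
    using fun_alg_zero_outside[OF f(1)] by (auto simp: indicator_def fun_eq_iff)
  then have "\<alpha> f = \<alpha> f * \<alpha> (indicator (closure \<Omega>))"
    using max_ideal_space_mult[OF assms f(1) fun_alg_indicator] by simp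
  then show ?thesis
    using f(2) by simp
qed

text \<open>If \<open>cmod (\<alpha> f) > B\<close>, then \<open>1 - f / \<alpha> f\<close> lies in the kernel of \<open>\<alpha>\<close> although it is invertible by
  the geometric series.\<close>

lemma character_contractive:
  assumes bdd: "bounded \<Omega>" and \<alpha>: "\<alpha> \<in> max_ideal_space (fun_alg \<Omega>)" and f: "f \<in> fun_alg \<Omega>"
    and B: "\<And>z. z \<in> closure \<Omega> \<Longrightarrow> cmod (f z) \<le> B" "0 \<le> B"
  shows "cmod (\<alpha> f) \<le> B"
proof (rule ccontr)
  assume "\<not> cmod (\<alpha> f) \<le> B"
  then have gt: "B < cmod (\<alpha> f)" and ne: "\<alpha> f \<noteq> 0"
    using B(2) by auto
  define u where "u z = (1 / \<alpha> f) * f z" for z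
  define g where "g z = indicator (closure \<Omega>) z / (1 - u z)" for z
  define r where "r = B / cmod (\<alpha> f)"
  have u: "u \<in> fun_alg \<Omega>"
    unfolding u_def by (rule fun_alg_scale[OF bdd f])
  have r: "r < 1" "0 \<le> r"
    using gt B(2) ne by (auto simp: r_def)
  have ur: "cmod (u z) \<le> r" if "z \<in> closure \<Omega>" for z
    using B(1)[OF that] ne by (simp add: u_def r_def norm_divide divide_right_mono)
  have g: "g \<in> fun_alg \<Omega>"
    unfolding g_def by (rule fun_alg_inverse_one_minus[OF bdd u r(1) ur r(2)])
  define v where "v z = - u z + 1 * indicator (closure \<Omega>) z" for z
  have mu: "(\<lambda>z. - u z) \<in> fun_alg \<Omega>"
    using fun_alg_scale[OF bdd u, of "- 1"] by simp
  have v: "v \<in> fun_alg \<Omega>"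
    unfolding v_def by (rule fun_alg_shift[OF bdd mu])
  have "\<alpha> u = 1"
    using max_ideal_space_scale[OF \<alpha> f, of "1 / \<alpha> f"] ne by (simp add: u_def[abs_def])
  moreover have "\<alpha> (\<lambda>z. - u z) = - \<alpha> u"
    using max_ideal_space_scale[OF \<alpha> u, of "- 1"] by simp
  ultimately have "\<alpha> v = 0"
    using max_ideal_space_add[OF \<alpha> mu fun_alg_indicator] max_ideal_space_indicator[OF \<alpha>]
    by (simp add: v_def[abs_def])
  have "v z * g z = indicator (closure \<Omega>) z" for z
  proof (cases "z \<in> closure \<Omega>")
    case True
    then have "u z \<noteq> 1"
      using ur[OF True] r(1) by auto
    then show ?thesis
      using True by (simp add: v_def g_def)
  qed (simp add: g_def)
  then have "\<alpha> (indicator (closure \<Omega>)) = \<alpha> v * \<alpha> g"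
    using max_ideal_space_mult[OF \<alpha> v g] by simp
  then show False
    using \<open>\<alpha> v = 0\<close> max_ideal_space_indicator[OF \<alpha>] by simp
qed

lemma point_char_in_max_ideal_space:
  assumes "bounded \<Omega>" "z \<in> closure \<Omega>"
  shows "point_char (fun_alg \<Omega>) z \<in> max_ideal_space (fun_alg \<Omega>)"
  using assms fun_alg_indicator[of \<Omega>]
  by (auto simp: max_ideal_space_def point_char_def fun_alg_add fun_alg_scale fun_alg_mult
      intro!: bexI[of _ "indicator (closure \<Omega>)"])

lemma fun_alg_attains_sup:
  assumes "bounded \<Omega>" "\<Omega> \<noteq> {}" "f \<in> fun_alg \<Omega>"
  obtains z0 where "z0 \<in> closure \<Omega>" "\<And>z. z \<in> closure \<Omega> \<Longrightarrow> cmod (f z) \<le> cmod (f z0)"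
proof -
  have "\<exists>z0\<in>closure \<Omega>. \<forall>z\<in>closure \<Omega>. cmod (f z) \<le> cmod (f z0)"
    using assms
    by (intro continuous_attains_sup continuous_on_norm fun_alg_continuous_on) simp_all
  then show thesis
    using that by blast
qed

lemma silov_boundary_subset:
  assumes "bounded \<Omega>" "\<Omega> \<noteq> {}"
  shows "silov_boundary (fun_alg \<Omega>) \<subseteq> max_ideal_space (fun_alg \<Omega>)"
proof -
  have "closed_boundary (fun_alg \<Omega>) (max_ideal_space (fun_alg \<Omega>))"
    unfolding closed_boundary_def
  proof (intro conjI ballI)
    fix f assume f: "f \<in> fun_alg \<Omega>"
    obtain z0 where z0: "z0 \<in> closure \<Omega>" "\<And>z. z \<in> closure \<Omega> \<Longrightarrow> cmod (f z) \<le> cmod (f z0)"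
      by (rule fun_alg_attains_sup[OF assms f]) (rule that)
    have "cmod (\<beta> f) \<le> cmod (point_char (fun_alg \<Omega>) z0 f)"
      if "\<beta> \<in> max_ideal_space (fun_alg \<Omega>)" for \<beta>
      using character_contractive[OF assms(1) that f z0(2)] f by (simp add: point_char_def)
    then show "\<exists>\<alpha>\<in>max_ideal_space (fun_alg \<Omega>). \<forall>\<beta>\<in>max_ideal_space (fun_alg \<Omega>).
        cmod (\<beta> f) \<le> cmod (\<alpha> f)"
      using point_char_in_max_ideal_space[OF assms(1) z0(1)] by blast
  qed simp
  then show ?thesis
    unfolding silov_boundary_def by blast
qed

lemma openin_character_neighbourhood:
  fixes \<alpha> :: "('x \<Rightarrow> complex) \<Rightarrow> complex"
  assumes "finite X"
  shows "openin (top_of_set M) {\<beta> \<in> M. \<forall>f\<in>X. cmod (\<beta> f - \<alpha> f) < (e::real)}"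
proof -
  have "open {\<beta> :: ('x \<Rightarrow> complex) \<Rightarrow> complex. cmod (\<beta> f - \<alpha> f) < e}" for f
    by (intro open_Collect_less continuous_intros continuous_on_product_coordinates)
  then have "open (\<Inter>f\<in>X. {\<beta> :: ('x \<Rightarrow> complex) \<Rightarrow> complex. cmod (\<beta> f - \<alpha> f) < e})"
    using assms by (intro open_INT) auto
  moreover have "{\<beta> \<in> M. \<forall>f\<in>X. cmod (\<beta> f - \<alpha> f) < e}
      = M \<inter> (\<Inter>f\<in>X. {\<beta>. cmod (\<beta> f - \<alpha> f) < e})"
    by auto
  ultimately show ?thesis
    by (auto simp: openin_open)
qed

text \<open>A function that peaks at \<open>\<alpha>\<close> and only inside the neighbourhood of \<open>\<alpha>\<close> given by \<open>X\<close> and \<open>e\<close> is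
  rescaled to the value 1 at \<open>\<alpha>\<close>. Scaling fails only for the zero function, but then the
  neighbourhood is the whole maximal ideal space and the unit will do.\<close>

lemma p_point_peak_function:
  assumes bdd: "bounded \<Omega>" and p: "p_point (fun_alg \<Omega>) \<alpha>" and X: "finite X" "X \<subseteq> fun_alg \<Omega>"
    and e: "e > 0"
  obtains f where "f \<in> fun_alg \<Omega>" "\<alpha> f = 1" "\<And>z. z \<in> closure \<Omega> \<Longrightarrow> cmod (f z) \<le> 1"
    "\<And>z \<psi>. z \<in> closure \<Omega> \<Longrightarrow> \<psi> \<in> X \<Longrightarrow> e \<le> cmod (\<psi> z - \<alpha> \<psi>) \<Longrightarrow> cmod (f z) < 1"
proof -
  let ?A = "fun_alg \<Omega>"
  let ?M = "max_ideal_space ?A"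
  define U where "U = {\<beta> \<in> ?M. \<forall>\<psi>\<in>X. cmod (\<beta> \<psi> - \<alpha> \<psi>) < e}"
  have \<alpha>: "\<alpha> \<in> ?M"
    using p by (simp add: p_point_def)
  have "openin (top_of_set ?M) U" "\<alpha> \<in> U"
    using openin_character_neighbourhood[OF X(1), of ?M \<alpha> e] \<alpha> e by (auto simp: U_def)
  then obtain f where f: "f \<in> ?A" "\<And>\<beta>. \<beta> \<in> ?M \<Longrightarrow> cmod (\<beta> f) \<le> cmod (\<alpha> f)"
    "\<And>\<beta>. \<beta> \<in> ?M - U \<Longrightarrow> cmod (\<beta> f) \<noteq> cmod (\<alpha> f)"
    using p unfolding p_point_def by metis
  have le: "cmod (f z) \<le> cmod (\<alpha> f)" if "z \<in> closure \<Omega>" for z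
    using f(1) f(2)[OF point_char_in_max_ideal_space[OF bdd that]] by (simp add: point_char_def)
  have less: "cmod (f z) < cmod (\<alpha> f)"
    if z: "z \<in> closure \<Omega>" and "\<psi> \<in> X" "e \<le> cmod (\<psi> z - \<alpha> \<psi>)" for z \<psi>
  proof -
    have "point_char ?A z \<psi> = \<psi> z"
      using X(2) that(2) by (auto simp: point_char_def)
    then have "point_char ?A z \<in> ?M - U"
      using that point_char_in_max_ideal_space[OF bdd z] by (force simp: U_def)
    then show ?thesis
      using f(1) f(3)[of "point_char ?A z"] le[OF z] by (simp add: point_char_def)
  qed
  show thesis
  proof (cases "\<alpha> f = 0")
    case True
    show thesis
    proof (rule that[of "indicator (closure \<Omega>)"])
      show "cmod (indicator (closure \<Omega>) z) < 1"
        if "z \<in> closure \<Omega>" "\<psi> \<in> X" "e \<le> cmod (\<psi> z - \<alpha> \<psi>)" for z \<psi>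
        using less[OF that] True by simp
    qed (use \<alpha> in \<open>auto simp: fun_alg_indicator max_ideal_space_indicator indicator_def\<close>)
  next
    case False
    show thesis
    proof (rule that[of "\<lambda>z. (1 / \<alpha> f) * f z"])
      show "(\<lambda>z. (1 / \<alpha> f) * f z) \<in> ?A"
        by (rule fun_alg_scale[OF bdd f(1)])
      show "\<alpha> (\<lambda>z. (1 / \<alpha> f) * f z) = 1"
        using max_ideal_space_scale[OF \<alpha> f(1), of "1 / \<alpha> f"] False by simp
    qed (use le less False in \<open>simp_all add: norm_divide\<close>)
  qed
qed

text \<open>The complement of an open neighbourhood of \<open>\<alpha>\<close> is closed and misses \<open>\<alpha>\<close>, hence is not a
  boundary: some function attains its maximum modulus nowhere on it. By contractivity the maximum is
  attained at a point of \<open>closure \<Omega>\<close>. It need not be attained at \<open>\<alpha>\<close> itself.\<close>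

lemma silov_boundary_peak_function:
  assumes bdd: "bounded \<Omega>" and ne: "\<Omega> \<noteq> {}" and s: "\<alpha> \<in> silov_boundary (fun_alg \<Omega>)"
    and X: "finite X" "X \<subseteq> fun_alg \<Omega>" and e: "e > 0"
  obtains f z0 where "f \<in> fun_alg \<Omega>" "z0 \<in> closure \<Omega>" "f z0 = 1"
    "\<And>z. z \<in> closure \<Omega> \<Longrightarrow> cmod (f z) \<le> 1"
    "\<And>z \<psi>. z \<in> closure \<Omega> \<Longrightarrow> \<psi> \<in> X \<Longrightarrow> e \<le> cmod (\<psi> z - \<alpha> \<psi>) \<Longrightarrow> cmod (f z) < 1"
proof -
  let ?A = "fun_alg \<Omega>"
  let ?M = "max_ideal_space ?A"
  define U where "U = {\<beta> \<in> ?M. \<forall>\<psi>\<in>X. cmod (\<beta> \<psi> - \<alpha> \<psi>) < e}"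
  have \<alpha>: "\<alpha> \<in> ?M"
    using s silov_boundary_subset[OF bdd ne] by blast
  have "openin (top_of_set ?M) U" "\<alpha> \<in> U"
    using openin_character_neighbourhood[OF X(1), of ?M \<alpha> e] \<alpha> e by (auto simp: U_def)
  then have "closedin (top_of_set ?M) (?M - U)"
    using closedin_diff[OF closedin_topspace[of "top_of_set ?M"], of U] by simp
  moreover have "\<not> closed_boundary ?A (?M - U)"
    using s \<open>\<alpha> \<in> U\<close> unfolding silov_boundary_def by blast
  ultimately obtain f where f: "f \<in> ?A"
    "\<And>\<beta>. \<beta> \<in> ?M - U \<Longrightarrow> \<exists>\<gamma>\<in>?M. cmod (\<beta> f) < cmod (\<gamma> f)"
    unfolding closed_boundary_def by (auto simp: not_le)
  obtain z0 where z0: "z0 \<in> closure \<Omega>" "\<And>z. z \<in> closure \<Omega> \<Longrightarrow> cmod (f z) \<le> cmod (f z0)"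
    by (rule fun_alg_attains_sup[OF bdd ne f(1)]) (rule that)
  have less: "cmod (f z) < cmod (f z0)"
    if z: "z \<in> closure \<Omega>" and "\<psi> \<in> X" "e \<le> cmod (\<psi> z - \<alpha> \<psi>)" for z \<psi>
  proof -
    have "point_char ?A z \<psi> = \<psi> z"
      using X(2) that(2) by (auto simp: point_char_def)
    then have "point_char ?A z \<in> ?M - U"
      using that point_char_in_max_ideal_space[OF bdd z] by (force simp: U_def)
    then obtain \<gamma> where "\<gamma> \<in> ?M" "cmod (f z) < cmod (\<gamma> f)"
      using f(1) f(2)[of "point_char ?A z"] by (auto simp: point_char_def)
    then show ?thesis
      using character_contractive[OF bdd _ f(1) z0(2), of \<gamma>] by simp
  qed
  show thesis
  proof (cases "f z0 = 0")
    case True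
    show thesis
    proof (rule that[of "indicator (closure \<Omega>)" z0])
      show "cmod (indicator (closure \<Omega>) z) < 1"
        if "z \<in> closure \<Omega>" "\<psi> \<in> X" "e \<le> cmod (\<psi> z - \<alpha> \<psi>)" for z \<psi>
        using less[OF that] True by simp
    qed (use z0 in \<open>auto simp: fun_alg_indicator indicator_def\<close>)
  next
    case False
    show thesis
    proof (rule that[of "\<lambda>z. (1 / f z0) * f z" z0])
      show "(\<lambda>z. (1 / f z0) * f z) \<in> ?A"
        by (rule fun_alg_scale[OF bdd f(1)])
    qed (use z0 less False in \<open>simp_all add: norm_divide\<close>)
  qed
qed

section \<open>Asymptotic eigenvalues\<close>

text \<open>The vectors in the ranges of the \<open>V z\<close> become joint eigenvectors of \<open>T\<close> and \<open>adj T\<close> along \<open>F\<close>,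
  uniformly on the unit ball. Requiring both halves makes the condition symmetric under adjoints,
  while each half alone is stable under sums, products and limits.\<close>

definition asymptotic_eigenvalue ::
  "'i filter \<Rightarrow> ('i \<Rightarrow> 'h::chilbert_space \<Rightarrow>\<^sub>L 'r::chilbert_space) \<Rightarrow> ('r \<Rightarrow>\<^sub>L 'r) \<Rightarrow> complex \<Rightarrow> bool"
  where "asymptotic_eigenvalue F V T c \<longleftrightarrow>
    ((\<lambda>z. (T o\<^sub>L V z) - op_scaleC c (V z)) \<longlongrightarrow> 0) F \<and>
    ((\<lambda>z. (adj T o\<^sub>L V z) - op_scaleC (cnj c) (V z)) \<longlongrightarrow> 0) F"

lemma tendsto_compose_left_zero:
  fixes S :: "'a::real_normed_vector \<Rightarrow>\<^sub>L 'b::real_normed_vector"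
    and W :: "'i \<Rightarrow> 'h::real_normed_vector \<Rightarrow>\<^sub>L 'a"
  assumes "(W \<longlongrightarrow> 0) F"
  shows "((\<lambda>z. S o\<^sub>L W z) \<longlongrightarrow> 0) F"
  using bounded_bilinear.tendsto[OF bounded_bilinear_blinfun_compose tendsto_const assms, of S]
  by (simp add: bounded_bilinear.zero_right[OF bounded_bilinear_blinfun_compose])

lemma tendsto_op_scaleC_zero:
  assumes "(W \<longlongrightarrow> 0) F"
  shows "((\<lambda>z. op_scaleC c (W z)) \<longlongrightarrow> 0) F"
proof -
  have "((\<lambda>z. cmod c * norm (W z)) \<longlongrightarrow> 0) F"
    using tendsto_mult_right_zero[OF tendsto_norm_zero[OF assms]] .
  then show ?thesis
    unfolding norm_op_scaleC[symmetric] by (rule tendsto_norm_zero_cancel)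
qed

lemma asymptotic_eigenvalue_zero:
  fixes V :: "'i \<Rightarrow> 'h::chilbert_space \<Rightarrow>\<^sub>L 'r::chilbert_space"
  shows "asymptotic_eigenvalue F V 0 0"
proof -
  have "(0 o\<^sub>L V z) - op_scaleC 0 (V z) = 0" for z
    by (intro blinfun_eqI) (simp add: blinfun.minus_left)
  moreover have "adj 0 = (0 :: 'r \<Rightarrow>\<^sub>L 'r)"
    by (rule adj_eqI) simp_all
  ultimately show ?thesis
    by (simp add: asymptotic_eigenvalue_def)
qed

lemma asymptotic_eigenvalue_add:
  fixes V :: "'i \<Rightarrow> 'h::chilbert_space \<Rightarrow>\<^sub>L 'r::chilbert_space"
  assumes "S \<in> bop" "T \<in> bop" "asymptotic_eigenvalue F V S c" "asymptotic_eigenvalue F V T d"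
  shows "asymptotic_eigenvalue F V (S + T) (c + d)"
proof -
  have "((S + T) o\<^sub>L V z) - op_scaleC (c + d) (V z)
      = ((S o\<^sub>L V z) - op_scaleC c (V z)) + ((T o\<^sub>L V z) - op_scaleC d (V z))"
    for S T :: "'r \<Rightarrow>\<^sub>L 'r" and c d z
    by (intro blinfun_eqI) (simp add: blinfun.add_left blinfun.diff_left scaleC_add_left)
  then show ?thesis
    using assms by (auto simp: asymptotic_eigenvalue_def adj_add intro: tendsto_add_zero)
qed

lemma asymptotic_eigenvalue_scaleC:
  fixes V :: "'i \<Rightarrow> 'h::chilbert_space \<Rightarrow>\<^sub>L 'r::chilbert_space"
  assumes "T \<in> bop" "asymptotic_eigenvalue F V T d"
  shows "asymptotic_eigenvalue F V (op_scaleC c T) (c * d)"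
proof -
  have "(op_scaleC c T o\<^sub>L V z) - op_scaleC (c * d) (V z)
      = op_scaleC c ((T o\<^sub>L V z) - op_scaleC d (V z))" for T :: "'r \<Rightarrow>\<^sub>L 'r" and c d z
    by (intro blinfun_eqI) (simp add: blinfun.diff_left scaleC_diff_right scaleC_scaleC)
  then show ?thesis
    using assms by (auto simp: asymptotic_eigenvalue_def adj_scaleC intro: tendsto_op_scaleC_zero)
qed

lemma asymptotic_eigenvalue_compose:
  fixes V :: "'i \<Rightarrow> 'h::chilbert_space \<Rightarrow>\<^sub>L 'r::chilbert_space"
  assumes "S \<in> bop" "T \<in> bop" "asymptotic_eigenvalue F V S c" "asymptotic_eigenvalue F V T d"
  shows "asymptotic_eigenvalue F V (S o\<^sub>L T) (c * d)"
proof -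
  have eq: "(S o\<^sub>L T o\<^sub>L V z) - op_scaleC (c * d) (V z)
      = (S o\<^sub>L ((T o\<^sub>L V z) - op_scaleC d (V z))) + op_scaleC d ((S o\<^sub>L V z) - op_scaleC c (V z))"
    if "S \<in> bop" for S T :: "'r \<Rightarrow>\<^sub>L 'r" and c d z
    by (intro blinfun_eqI)
       (simp add: blinfun.diff_left blinfun.diff_right blinfun.add_left scaleC_diff_right
          scaleC_scaleC bopD[OF that] mult.commute)
  have lim: "((\<lambda>z. (S o\<^sub>L T o\<^sub>L V z) - op_scaleC (c * d) (V z)) \<longlongrightarrow> 0) F"
    if "S \<in> bop" "((\<lambda>z. (S o\<^sub>L V z) - op_scaleC c (V z)) \<longlongrightarrow> 0) F"
      "((\<lambda>z. (T o\<^sub>L V z) - op_scaleC d (V z)) \<longlongrightarrow> 0) F" for S T c d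
    unfolding eq[OF that(1)]
    by (intro tendsto_add_zero tendsto_compose_left_zero tendsto_op_scaleC_zero that)
  show ?thesis
    unfolding asymptotic_eigenvalue_def
  proof
    show "((\<lambda>z. (S o\<^sub>L T o\<^sub>L V z) - op_scaleC (c * d) (V z)) \<longlongrightarrow> 0) F"
      using assms by (intro lim) (auto simp: asymptotic_eigenvalue_def)
    have "((\<lambda>z. (adj T o\<^sub>L adj S o\<^sub>L V z) - op_scaleC (cnj d * cnj c) (V z)) \<longlongrightarrow> 0) F"
      using assms by (intro lim) (auto simp: asymptotic_eigenvalue_def)
    then show "((\<lambda>z. (adj (S o\<^sub>L T) o\<^sub>L V z) - op_scaleC (cnj (c * d)) (V z)) \<longlongrightarrow> 0) F"
      using assms by (simp add: adj_compose mult.commute)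
  qed
qed

lemma asymptotic_eigenvalue_adj:
  assumes "T \<in> bop" "asymptotic_eigenvalue F V T c"
  shows "asymptotic_eigenvalue F V (adj T) (cnj c)"
  using assms by (simp add: asymptotic_eigenvalue_def adj_adj)

lemma asymptotic_eigenvalue_bound:
  assumes F: "F \<noteq> bot" "\<forall>\<^sub>F z in F. norm (V z) = 1" and T: "asymptotic_eigenvalue F V T c"
  shows "cmod c \<le> norm T"
proof (rule field_le_epsilon)
  fix e :: real assume e: "e > 0"
  have "((\<lambda>z. norm ((T o\<^sub>L V z) - op_scaleC c (V z))) \<longlongrightarrow> 0) F"
    using T by (intro tendsto_norm_zero) (simp add: asymptotic_eigenvalue_def)
  then have "\<forall>\<^sub>F z in F. norm ((T o\<^sub>L V z) - op_scaleC c (V z)) < e"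
    using e by (rule order_tendstoD)
  then have "\<forall>\<^sub>F z in F. cmod c \<le> norm T + e"
    using F(2)
  proof eventually_elim
    case (elim z)
    have "cmod c = norm (op_scaleC c (V z))"
      using elim by (simp add: norm_op_scaleC)
    also have "\<dots> \<le> norm (T o\<^sub>L V z) + norm ((T o\<^sub>L V z) - op_scaleC c (V z))"
      using norm_triangle_ineq4[of "T o\<^sub>L V z" "(T o\<^sub>L V z) - op_scaleC c (V z)"] by simp
    also have "norm (T o\<^sub>L V z) \<le> norm T"
      using norm_blinfun_compose[of T "V z"] elim by simp
    finally show ?case
      using elim by simp
  qed
  then show "cmod c \<le> norm T + e"
    using F(1) by simp
qed

lemma asymptotic_eigenvalue_dist:
  assumes F: "F \<noteq> bot" "\<forall>\<^sub>F z in F. norm (V z) = 1" and "S \<in> bop" "T \<in> bop"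
    and "asymptotic_eigenvalue F V S c" "asymptotic_eigenvalue F V T d"
  shows "dist c d \<le> dist S T"
proof -
  have "S + op_scaleC (- 1) T = S - T"
    by (intro blinfun_eqI) (simp add: blinfun.add_left blinfun.diff_left scaleC_minus_left)
  then have "asymptotic_eigenvalue F V (S - T) (c + - 1 * d)"
    using asymptotic_eigenvalue_add[OF assms(3) bop_scaleC[OF assms(4)] assms(5)
        asymptotic_eigenvalue_scaleC[OF assms(4,6), of "- 1"]] by simp
  then show ?thesis
    using asymptotic_eigenvalue_bound[OF F] by (fastforce simp: dist_norm)
qed

lemma asymptotic_eigenvalue_unique:
  assumes "F \<noteq> bot" "\<forall>\<^sub>F z in F. norm (V z) = 1" "T \<in> bop"
    and "asymptotic_eigenvalue F V T c" "asymptotic_eigenvalue F V T d"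
  shows "c = d"
  using asymptotic_eigenvalue_dist[OF assms(1-3,3-5)] by simp

lemma asymptotic_eigenvalue_limit:
  fixes T :: "nat \<Rightarrow> 'r::chilbert_space \<Rightarrow>\<^sub>L 'r"
  assumes V: "\<forall>\<^sub>F z in F. norm (V z) = 1"
    and T: "\<And>n. T n \<in> bop" "\<And>n. asymptotic_eigenvalue F V (T n) (c n)"
    and lim: "T \<longlonglongrightarrow> T'" "c \<longlonglongrightarrow> c'"
  shows "asymptotic_eigenvalue F V T' c'"
proof -
  have T': "T' \<in> bop"
    using closed_sequentially[OF closed_bop _ lim(1)] T(1) by blast
  have main: "((\<lambda>z. (S' o\<^sub>L V z) - op_scaleC d' (V z)) \<longlongrightarrow> 0) F"
    if S: "\<And>n. ((\<lambda>z. (S n o\<^sub>L V z) - op_scaleC (d n) (V z)) \<longlongrightarrow> 0) F"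
      and lim: "S \<longlonglongrightarrow> S'" "d \<longlonglongrightarrow> d'" for S d S' d'
  proof (rule tendstoI)
    fix e :: real assume e: "e > 0"
    then have "e / 3 > 0"
      by simp
    with lim have "\<forall>\<^sub>F n in sequentially. dist (S n) S' < e / 3 \<and> dist (d n) d' < e / 3"
      by (intro eventually_conj tendstoD)
    then obtain n where n: "dist (S n) S' < e / 3" "dist (d n) d' < e / 3"
      by (auto simp: eventually_sequentially)
    have "\<forall>\<^sub>F z in F. dist ((S n o\<^sub>L V z) - op_scaleC (d n) (V z)) 0 < e / 3"
      using S \<open>e / 3 > 0\<close> by (rule tendstoD)
    then show "\<forall>\<^sub>F z in F. dist ((S' o\<^sub>L V z) - op_scaleC d' (V z)) 0 < e"
      using V
    proof eventually_elim
      case (elim z)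
      have "(S' o\<^sub>L V z) - op_scaleC d' (V z) = ((S' - S n) o\<^sub>L V z) + op_scaleC (d n - d') (V z)
          + ((S n o\<^sub>L V z) - op_scaleC (d n) (V z))"
        by (intro blinfun_eqI) (simp add: blinfun.add_left blinfun.diff_left scaleC_diff_left)
      then have "norm ((S' o\<^sub>L V z) - op_scaleC d' (V z)) \<le> norm ((S' - S n) o\<^sub>L V z)
          + norm (op_scaleC (d n - d') (V z)) + norm ((S n o\<^sub>L V z) - op_scaleC (d n) (V z))"
        by (metis norm_triangle_le norm_triangle_ineq add_mono order_refl)
      moreover have "norm ((S' - S n) o\<^sub>L V z) < e / 3"
        using norm_blinfun_compose[of "S' - S n" "V z"] n(1) elim
        by (simp add: dist_norm norm_minus_commute)
      moreover have "norm (op_scaleC (d n - d') (V z)) < e / 3"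
        using n(2) elim by (simp add: norm_op_scaleC dist_norm)
      ultimately show ?case
        using elim by simp
    qed
  qed
  have "(\<lambda>n. adj (T n)) \<longlonglongrightarrow> adj T'"
  proof -
    have "norm (adj (T n) - adj T') = norm (T n - T')" for n
      using T(1) T' by (metis adj_diff bop_diff norm_adj)
    then show ?thesis
      using lim(1) by (simp add: tendsto_iff dist_norm)
  qed
  then show ?thesis
    using main[of T c T' c'] main[of "\<lambda>n. adj (T n)" "\<lambda>n. cnj (c n)" "adj T'" "cnj c'"] T(2) lim
    by (simp add: asymptotic_eigenvalue_def tendsto_cnj)
qed

text \<open>Closure under limits is where the estimate \<open>dist c d \<le> dist S T\<close> is needed: it turns norm
  convergence of the operators into uniform convergence of their symbols.\<close>

lemma cstar_subalgebra_continuous_symbol: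
  fixes V :: "'i \<Rightarrow> 'h::chilbert_space \<Rightarrow>\<^sub>L 'r::chilbert_space" and K :: "'k::topological_space set"
  assumes F: "\<And>\<alpha>. \<alpha> \<in> K \<Longrightarrow> F \<alpha> \<noteq> bot" "\<And>\<alpha>. \<alpha> \<in> K \<Longrightarrow> \<forall>\<^sub>F z in F \<alpha>. norm (V z) = 1"
  shows "cstar_subalgebra {T \<in> bop. \<exists>s. continuous_on K s \<and>
    (\<forall>\<alpha>\<in>K. asymptotic_eigenvalue (F \<alpha>) V T (s \<alpha>))}" (is "cstar_subalgebra ?S")
  unfolding cstar_subalgebra_def
proof (intro conjI ballI allI)
  show "?S \<subseteq> bop"
    by blast
  show "0 \<in> ?S"
    by (auto intro!: exI[of _ "\<lambda>_. 0"] asymptotic_eigenvalue_zero)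
  show "closed ?S"
    unfolding closed_sequential_limits
  proof safe
    fix T :: "nat \<Rightarrow> 'r \<Rightarrow>\<^sub>L 'r" and T'
    assume "\<forall>n. T n \<in> ?S" and lim: "T \<longlonglongrightarrow> T'"
    then have T: "T n \<in> bop" and "\<exists>s. continuous_on K s \<and>
        (\<forall>\<alpha>\<in>K. asymptotic_eigenvalue (F \<alpha>) V (T n) (s \<alpha>))" for n
      by auto
    then obtain s where s: "\<And>n. continuous_on K (s n)"
      "\<And>n \<alpha>. \<alpha> \<in> K \<Longrightarrow> asymptotic_eigenvalue (F \<alpha>) V (T n) (s n \<alpha>)"
      by metis
    show "T' \<in> bop"
      using closed_sequentially[OF closed_bop _ lim] T by blast
    have "uniformly_Cauchy_on K s"
    proof (rule uniformly_Cauchy_onI)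
      fix e :: real assume "e > 0"
      then obtain M where M: "\<And>m n. m \<ge> M \<Longrightarrow> n \<ge> M \<Longrightarrow> dist (T m) (T n) < e"
        using LIMSEQ_imp_Cauchy[OF lim] unfolding Cauchy_def by blast
      have "dist (s m \<alpha>) (s n \<alpha>) < e" if "\<alpha> \<in> K" "m \<ge> M" "n \<ge> M" for \<alpha> m n
        using asymptotic_eigenvalue_dist[OF F(1)[OF that(1)] F(2)[OF that(1)] T T s(2)[OF that(1)] s(2)[OF that(1)]]
          M[OF that(2,3)] by (rule order_le_less_trans)
      then show "\<exists>M. \<forall>\<alpha>\<in>K. \<forall>m\<ge>M. \<forall>n\<ge>M. dist (s m \<alpha>) (s n \<alpha>) < e"
        by blast
    qed
    then obtain s' where s': "uniform_limit K s s' sequentially"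
      using uniformly_convergent_eq_Cauchy uniformly_convergent_on_def by blast
    have "continuous_on K s'"
      by (rule uniform_limit_theorem[OF _ s']) (use s(1) in auto)
    moreover have "asymptotic_eigenvalue (F \<alpha>) V T' (s' \<alpha>)" if "\<alpha> \<in> K" for \<alpha>
      by (rule asymptotic_eigenvalue_limit[OF F(2)[OF that] T s(2)[OF that] lim
            tendsto_uniform_limitI[OF s' that]])
    ultimately show "\<exists>s. continuous_on K s \<and> (\<forall>\<alpha>\<in>K. asymptotic_eigenvalue (F \<alpha>) V T' (s \<alpha>))"
      by blast
  qed
next
  fix X Y assume "X \<in> ?S" "Y \<in> ?S"
  then obtain s t where XY: "X \<in> bop" "Y \<in> bop" "continuous_on K s" "continuous_on K t"
    "\<forall>\<alpha>\<in>K. asymptotic_eigenvalue (F \<alpha>) V X (s \<alpha>)" "\<forall>\<alpha>\<in>K. asymptotic_eigenvalue (F \<alpha>) V Y (t \<alpha>)"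
    by blast
  show "X + Y \<in> ?S"
    using XY by (auto simp: bop_add intro!: exI[of _ "\<lambda>\<alpha>. s \<alpha> + t \<alpha>"]
        asymptotic_eigenvalue_add continuous_on_add)
  show "X o\<^sub>L Y \<in> ?S"
    using XY by (auto simp: bop_compose intro!: exI[of _ "\<lambda>\<alpha>. s \<alpha> * t \<alpha>"]
        asymptotic_eigenvalue_compose continuous_on_mult)
next
  fix c X assume "X \<in> ?S"
  then obtain s where "X \<in> bop" "continuous_on K s" "\<forall>\<alpha>\<in>K. asymptotic_eigenvalue (F \<alpha>) V X (s \<alpha>)"
    by blast
  then show "op_scaleC c X \<in> ?S"
    by (auto simp: bop_scaleC intro!: exI[of _ "\<lambda>\<alpha>. c * s \<alpha>"] asymptotic_eigenvalue_scaleC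
        continuous_on_mult continuous_on_const)
next
  fix X assume "X \<in> ?S"
  then obtain s where "X \<in> bop" "continuous_on K s" "\<forall>\<alpha>\<in>K. asymptotic_eigenvalue (F \<alpha>) V X (s \<alpha>)"
    by blast
  then show "adj X \<in> ?S"
    by (auto intro!: exI[of _ "\<lambda>\<alpha>. cnj (s \<alpha>)"] asymptotic_eigenvalue_adj continuous_on_cnj)
qed

section \<open>The C*-algebra generated by a set\<close>

lemma cstar_generated_minimal: "cstar_subalgebra S \<Longrightarrow> G \<subseteq> S \<Longrightarrow> cstar_generated G \<subseteq> S"
  unfolding cstar_generated_def by blast

lemma cstar_subalgebra_generated:
  assumes "cstar_subalgebra S" "G \<subseteq> S"
  shows "cstar_subalgebra (cstar_generated G)"
proof -
  have "cstar_generated G \<subseteq> bop"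
    using cstar_generated_minimal[OF assms] assms(1) unfolding cstar_subalgebra_def by blast
  moreover have "closed (cstar_generated G)"
    unfolding cstar_generated_def by (rule closed_Inter) (simp add: cstar_subalgebra_def)
  ultimately show ?thesis
    unfolding cstar_subalgebra_def by (auto simp: cstar_generated_def cstar_subalgebra_def)
qed

lemma null_space_closed_ideal:
  fixes \<Phi> :: "('r::chilbert_space \<Rightarrow>\<^sub>L 'r) \<Rightarrow> 'k::topological_space \<Rightarrow> complex"
  assumes S: "cstar_subalgebra S" and hom: "star_hom_C S K \<Phi>"
    and contr: "\<And>X Y \<alpha>. X \<in> S \<Longrightarrow> Y \<in> S \<Longrightarrow> \<alpha> \<in> K \<Longrightarrow> dist (\<Phi> X \<alpha>) (\<Phi> Y \<alpha>) \<le> dist X Y"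
  shows "closed_ideal S (null_space S K \<Phi>)"
proof -
  have alg: "\<Phi> (X + Y) \<alpha> = \<Phi> X \<alpha> + \<Phi> Y \<alpha>" "\<Phi> (op_scaleC c X) \<alpha> = c * \<Phi> X \<alpha>"
    "\<Phi> (X o\<^sub>L Y) \<alpha> = \<Phi> X \<alpha> * \<Phi> Y \<alpha>" if "\<alpha> \<in> K" "X \<in> S" "Y \<in> S" for X Y c \<alpha>
    using hom that unfolding star_hom_C_def by simp_all
  have S': "0 \<in> S" "closed S" "\<And>X Y. X \<in> S \<Longrightarrow> Y \<in> S \<Longrightarrow> X + Y \<in> S"
    "\<And>X Y. X \<in> S \<Longrightarrow> Y \<in> S \<Longrightarrow> X o\<^sub>L Y \<in> S" "\<And>c X. X \<in> S \<Longrightarrow> op_scaleC c X \<in> S"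
    using S unfolding cstar_subalgebra_def by simp_all
  have zero: "\<Phi> 0 \<alpha> = 0" if "\<alpha> \<in> K" for \<alpha>
    using alg(1)[OF that S'(1) S'(1)] by simp
  have "closed (null_space S K \<Phi>)"
    unfolding closed_sequential_limits
  proof safe
    fix T T' assume T: "\<forall>n. T n \<in> null_space S K \<Phi>" and lim: "T \<longlonglongrightarrow> T'"
    have T': "T' \<in> S"
      using closed_sequentially[OF S'(2) _ lim] T by (simp add: null_space_def)
    moreover have "\<Phi> T' \<alpha> = 0" if "\<alpha> \<in> K" for \<alpha>
    proof -
      have "norm (\<Phi> T' \<alpha>) \<le> dist (T n) T'" for n
        using contr[of "T n" T' \<alpha>] T T' that by (simp add: null_space_def dist_norm)
      moreover have "(\<lambda>n. dist (T n) T') \<longlonglongrightarrow> 0"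
        using lim by (rule tendsto_dist_iff[THEN iffD1])
      ultimately have "norm (\<Phi> T' \<alpha>) \<le> 0"
        by (intro LIMSEQ_le_const) auto
      then show ?thesis
        by simp
    qed
    ultimately show "T' \<in> null_space S K \<Phi>"
      by (simp add: null_space_def)
  qed
  then show ?thesis
    using S' alg zero unfolding closed_ideal_def null_space_def by auto
qed

lemma commutator_ideal_subset_null_space:
  fixes \<Phi> :: "('r::chilbert_space \<Rightarrow>\<^sub>L 'r) \<Rightarrow> 'k::topological_space \<Rightarrow> complex"
  assumes S: "cstar_subalgebra S" and hom: "star_hom_C S K \<Phi>"
    and ideal: "closed_ideal S (null_space S K \<Phi>)"
  shows "commutator_ideal S \<subseteq> null_space S K \<Phi>"
proof -
  have "(X o\<^sub>L Y) - (Y o\<^sub>L X) \<in> null_space S K \<Phi>" if XY: "X \<in> S" "Y \<in> S" for X Y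
  proof -
    have eq: "(X o\<^sub>L Y) - (Y o\<^sub>L X) = (X o\<^sub>L Y) + op_scaleC (- 1) (Y o\<^sub>L X)"
      by (intro blinfun_eqI) (simp add: blinfun.add_left blinfun.diff_left scaleC_minus_left)
    have mem: "X o\<^sub>L Y \<in> S" "Y o\<^sub>L X \<in> S" "op_scaleC (- 1) (Y o\<^sub>L X) \<in> S"
      "(X o\<^sub>L Y) + op_scaleC (- 1) (Y o\<^sub>L X) \<in> S"
      using S XY unfolding cstar_subalgebra_def by simp_all
    have "\<Phi> ((X o\<^sub>L Y) + op_scaleC (- 1) (Y o\<^sub>L X)) \<alpha> = 0" if "\<alpha> \<in> K" for \<alpha>
      using hom mem XY that unfolding star_hom_C_def by simp
    then show ?thesis
      unfolding eq using mem by (simp add: null_space_def)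
  qed
  then show ?thesis
    using ideal unfolding commutator_ideal_def by blast
qed

section \<open>Evaluation and multiplication on a quasi-free module\<close>

lemma alg_tensor_zero: "(\<lambda>_. 0) \<in> alg_tensor \<Omega>"
  unfolding alg_tensor_def
  by (intro CollectI exI[of _ "0::nat"]) simp

lemma alg_tensor_add_elementary:
  assumes F: "F \<in> alg_tensor \<Omega>" and \<theta>: "\<theta> \<in> fun_alg \<Omega>"
  shows "(\<lambda>z. F z + \<theta> z *\<^sub>C x) \<in> alg_tensor \<Omega>"
proof -
  obtain k :: nat and \<theta>' x' where k: "\<forall>i<k. \<theta>' i \<in> fun_alg \<Omega>" "F = (\<lambda>z. \<Sum>i<k. \<theta>' i z *\<^sub>C x' i)"
    using F unfolding alg_tensor_def by blast
  have "(\<lambda>z. F z + \<theta> z *\<^sub>C x) = (\<lambda>z. \<Sum>i<Suc k. (\<theta>'(k := \<theta>)) i z *\<^sub>C (x'(k := x)) i)"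
    unfolding k(2) by (simp add: fun_eq_iff)
  moreover have "\<forall>i<Suc k. (\<theta>'(k := \<theta>)) i \<in> fun_alg \<Omega>"
    using k(1) \<theta> by simp
  ultimately show ?thesis
    unfolding alg_tensor_def by blast
qed

lemma alg_tensor_add:
  assumes F: "F \<in> alg_tensor \<Omega>" and G: "G \<in> alg_tensor \<Omega>"
  shows "(\<lambda>z. F z + G z) \<in> alg_tensor \<Omega>"
proof -
  obtain k :: nat and \<theta> x where k: "\<forall>i<k. \<theta> i \<in> fun_alg \<Omega>" "G = (\<lambda>z. \<Sum>i<k. \<theta> i z *\<^sub>C x i)"
    using G unfolding alg_tensor_def by blast
  have "l \<le> k \<Longrightarrow> (\<lambda>z. F z + (\<Sum>i<l. \<theta> i z *\<^sub>C x i)) \<in> alg_tensor \<Omega>" for l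
  proof (induction l)
    case 0
    then show ?case
      using F by simp
  next
    case (Suc l)
    then show ?case
      using alg_tensor_add_elementary[of "\<lambda>z. F z + (\<Sum>i<l. \<theta> i z *\<^sub>C x i)" \<Omega> "\<theta> l" "x l"] k(1)
      by (simp add: add.assoc)
  qed
  then show ?thesis
    unfolding k(2) by blast
qed

lemma alg_tensor_mult:
  assumes "bounded \<Omega>" "\<phi> \<in> fun_alg \<Omega>" "F \<in> alg_tensor \<Omega>"
  shows "(\<lambda>z. \<phi> z *\<^sub>C F z) \<in> alg_tensor \<Omega>"
proof -
  obtain k :: nat and \<theta> x where k: "\<forall>i<k. \<theta> i \<in> fun_alg \<Omega>" "F = (\<lambda>z. \<Sum>i<k. \<theta> i z *\<^sub>C x i)"
    using assms(3) unfolding alg_tensor_def by blast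
  have "c *\<^sub>C (\<Sum>i<l. \<theta> i z *\<^sub>C x i) = (\<Sum>i<l. (c * \<theta> i z) *\<^sub>C x i)" for c l z
    by (induction l) (simp_all add: scaleC_add_right scaleC_scaleC)
  then have "(\<lambda>z. \<phi> z *\<^sub>C F z) = (\<lambda>z. \<Sum>i<k. (\<lambda>z. \<phi> z * \<theta> i z) z *\<^sub>C x i)"
    unfolding k(2) by simp
  moreover have "\<forall>i<k. (\<lambda>z. \<phi> z * \<theta> i z) \<in> fun_alg \<Omega>"
    using k(1) assms by (simp add: fun_alg_mult)
  ultimately show ?thesis
    unfolding alg_tensor_def mem_Collect_eq by (intro exI conjI)
qed

lemma alg_tensor_zero_outside:
  assumes "F \<in> alg_tensor \<Omega>" "z \<notin> closure \<Omega>"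
  shows "F z = 0"
proof -
  obtain k :: nat and \<theta> x where k: "\<forall>i<k. \<theta> i \<in> fun_alg \<Omega>" "F = (\<lambda>z. \<Sum>i<k. \<theta> i z *\<^sub>C x i)"
    using assms(1) unfolding alg_tensor_def by blast
  have "\<theta> i z = 0" if "i < k" for i
    using fun_alg_zero_outside[OF k(1)[rule_format, OF that] assms(2)] .
  then show ?thesis
    unfolding k(2) by simp
qed

lemma alg_tensor_scaleC:
  assumes "bounded \<Omega>" "F \<in> alg_tensor \<Omega>"
  shows "(\<lambda>z. c *\<^sub>C F z) \<in> alg_tensor \<Omega>"
proof -
  have "(\<lambda>z. (c * indicator (closure \<Omega>) z) *\<^sub>C F z) = (\<lambda>z. c *\<^sub>C F z)"
    using alg_tensor_zero_outside[OF assms(2)] by (auto simp: fun_eq_iff indicator_def)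
  then show ?thesis
    using alg_tensor_mult[OF assms(1) fun_alg_scale[OF assms(1) fun_alg_indicator, of c] assms(2)]
    by simp
qed

locale quasi_free_module =
  fixes \<Omega> :: "(complex ^ 'n) set"
    and \<iota> :: "(complex ^ 'n \<Rightarrow> complex ^ 'm) \<Rightarrow> 'r::chilbert_space"
  assumes bounded_domain: "bounded \<Omega>" and nonempty_domain: "\<Omega> \<noteq> {}"
    and quasi_free: "quasi_free \<Omega> \<iota>"
begin

abbreviation A where "A \<equiv> fun_alg \<Omega>"
abbreviation M where "M \<equiv> mult_op \<Omega> \<iota>"
abbreviation E where "E \<equiv> eval_op \<Omega> \<iota>"
abbreviation V where "V \<equiv> polar_isometry \<Omega> \<iota>"
abbreviation one where "one \<equiv> indicator (closure \<Omega>) :: complex ^ 'n \<Rightarrow> complex"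

lemma embed_add: "F \<in> alg_tensor \<Omega> \<Longrightarrow> G \<in> alg_tensor \<Omega> \<Longrightarrow> \<iota> (\<lambda>z. F z + G z) = \<iota> F + \<iota> G"
  and embed_scaleC: "F \<in> alg_tensor \<Omega> \<Longrightarrow> \<iota> (\<lambda>z. c *\<^sub>C F z) = c *\<^sub>C \<iota> F"
  and embed_inj: "inj_on \<iota> (alg_tensor \<Omega>)"
  and embed_dense: "closure (\<iota> ` alg_tensor \<Omega>) = UNIV"
  and eval_bound: "z \<in> \<Omega> \<Longrightarrow> \<exists>C. \<forall>F\<in>alg_tensor \<Omega>. norm (F z) \<le> C * norm (\<iota> F)"
  and mult_bound: "\<phi> \<in> A \<Longrightarrow> F \<in> alg_tensor \<Omega> \<Longrightarrow>
      norm (\<iota> (\<lambda>z. \<phi> z *\<^sub>C F z)) \<le> sup_norm \<Omega> \<phi> * norm (\<iota> F)"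
  using quasi_free unfolding quasi_free_def by simp_all

lemma embed_extension:
  fixes e :: "(complex ^ 'n \<Rightarrow> complex ^ 'm) \<Rightarrow> 'b::chilbert_space"
  assumes "\<And>F G. F \<in> alg_tensor \<Omega> \<Longrightarrow> G \<in> alg_tensor \<Omega> \<Longrightarrow> e (\<lambda>z. F z + G z) = e F + e G"
    and "\<And>c F. F \<in> alg_tensor \<Omega> \<Longrightarrow> e (\<lambda>z. c *\<^sub>C F z) = c *\<^sub>C e F"
    and "\<And>F. F \<in> alg_tensor \<Omega> \<Longrightarrow> norm (e F) \<le> C * norm (\<iota> F)" "0 \<le> C"
  defines "T \<equiv> THE T. \<forall>F\<in>alg_tensor \<Omega>. blinfun_apply T (\<iota> F) = e F"
  shows "T \<in> bop" "F \<in> alg_tensor \<Omega> \<Longrightarrow> blinfun_apply T (\<iota> F) = e F" "norm T \<le> C"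
proof -
  define g where "g = e \<circ> inv_into (alg_tensor \<Omega>) \<iota>"
  have g: "g (\<iota> F) = e F" if "F \<in> alg_tensor \<Omega>" for F
    using that embed_inj by (simp add: g_def)
  have "\<exists>S\<in>bop. (\<forall>x\<in>\<iota> ` alg_tensor \<Omega>. blinfun_apply S x = g x) \<and> norm S \<le> C"
  proof (rule bounded_extension_from_dense[OF embed_dense])
    show "x + y \<in> \<iota> ` alg_tensor \<Omega>" if "x \<in> \<iota> ` alg_tensor \<Omega>" "y \<in> \<iota> ` alg_tensor \<Omega>" for x y
      using that by (auto simp flip: embed_add intro: alg_tensor_add)
    show "c *\<^sub>C x \<in> \<iota> ` alg_tensor \<Omega>" if "x \<in> \<iota> ` alg_tensor \<Omega>" for c x
      using that bounded_domain by (auto simp flip: embed_scaleC intro: alg_tensor_scaleC)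
    show "g (x + y) = g x + g y" if "x \<in> \<iota> ` alg_tensor \<Omega>" "y \<in> \<iota> ` alg_tensor \<Omega>" for x y
      using that by (auto simp flip: embed_add simp: g alg_tensor_add assms(1))
    show "g (c *\<^sub>C x) = c *\<^sub>C g x" if "x \<in> \<iota> ` alg_tensor \<Omega>" for c x
      using that bounded_domain
      by (auto simp flip: embed_scaleC simp: g alg_tensor_scaleC assms(2))
    show "norm (g x) \<le> C * norm x" if "x \<in> \<iota> ` alg_tensor \<Omega>" for x
      using that by (auto simp: g assms(3))
  qed (rule assms(4))
  then obtain S where S: "S \<in> bop" "\<And>F. F \<in> alg_tensor \<Omega> \<Longrightarrow> blinfun_apply S (\<iota> F) = e F" "norm S \<le> C"
    using g by auto
  have "T = S"
    unfolding T_def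
  proof (rule the_equality)
    fix T' assume "\<forall>F\<in>alg_tensor \<Omega>. blinfun_apply T' (\<iota> F) = e F"
    then show "T' = S"
      using S(2) by (intro blinfun_eqI_dense[OF embed_dense]) auto
  qed (use S(2) in blast)
  then show "T \<in> bop" "F \<in> alg_tensor \<Omega> \<Longrightarrow> blinfun_apply T (\<iota> F) = e F" "norm T \<le> C"
    using S by simp_all
qed

lemma eval_op:
  assumes "z \<in> \<Omega>"
  shows "E z \<in> bop" "F \<in> alg_tensor \<Omega> \<Longrightarrow> blinfun_apply (E z) (\<iota> F) = F z"
proof -
  obtain C where C: "\<And>F. F \<in> alg_tensor \<Omega> \<Longrightarrow> norm (F z) \<le> C * norm (\<iota> F)"
    using eval_bound[OF assms] by blast
  have "norm (F z) \<le> \<bar>C\<bar> * norm (\<iota> F)" if "F \<in> alg_tensor \<Omega>" for F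
    by (rule order_trans[OF C[OF that]]) (simp add: mult_right_mono)
  then show "E z \<in> bop" "F \<in> alg_tensor \<Omega> \<Longrightarrow> blinfun_apply (E z) (\<iota> F) = F z"
    using embed_extension[of "\<lambda>F. F z" "\<bar>C\<bar>"] unfolding eval_op_def by simp_all
qed

lemma
  assumes \<phi>: "\<phi> \<in> A"
  shows mult_op_bop: "M \<phi> \<in> bop"
    and mult_op_embed: "F \<in> alg_tensor \<Omega> \<Longrightarrow> blinfun_apply (M \<phi>) (\<iota> F) = \<iota> (\<lambda>z. \<phi> z *\<^sub>C F z)"
    and norm_mult_op_le: "(\<And>z. z \<in> closure \<Omega> \<Longrightarrow> cmod (\<phi> z) \<le> B) \<Longrightarrow> norm (M \<phi>) \<le> B"
proof -
  obtain z0 where z0: "z0 \<in> closure \<Omega>" "\<And>z. z \<in> closure \<Omega> \<Longrightarrow> cmod (\<phi> z) \<le> cmod (\<phi> z0)"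
    by (rule fun_alg_attains_sup[OF bounded_domain nonempty_domain \<phi>]) (rule that)
  then have "cmod (\<phi> z0) \<le> sup_norm \<Omega> \<phi>"
    unfolding sup_norm_def by (intro cSUP_upper bdd_aboveI2) auto
  then have nonneg: "0 \<le> sup_norm \<Omega> \<phi>"
    using norm_ge_zero order_trans by blast
  have 1: "\<iota> (\<lambda>z. \<phi> z *\<^sub>C (F z + G z)) = \<iota> (\<lambda>z. \<phi> z *\<^sub>C F z) + \<iota> (\<lambda>z. \<phi> z *\<^sub>C G z)"
    if "F \<in> alg_tensor \<Omega>" "G \<in> alg_tensor \<Omega>" for F G
    using that by (simp add: scaleC_add_right embed_add alg_tensor_mult bounded_domain \<phi>)
  have 2: "\<iota> (\<lambda>z. \<phi> z *\<^sub>C c *\<^sub>C F z) = c *\<^sub>C \<iota> (\<lambda>z. \<phi> z *\<^sub>C F z)" if "F \<in> alg_tensor \<Omega>" for F c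
  proof -
    have "\<phi> z *\<^sub>C c *\<^sub>C F z = c *\<^sub>C \<phi> z *\<^sub>C F z" for z
      by (simp add: scaleC_scaleC mult.commute)
    then show ?thesis
      using embed_scaleC[OF alg_tensor_mult[OF bounded_domain \<phi> that]] by simp
  qed
  note ext = embed_extension[of "\<lambda>F. \<iota> (\<lambda>z. \<phi> z *\<^sub>C F z)" "sup_norm \<Omega> \<phi>",
      OF 1 2 mult_bound[OF \<phi>] nonneg, folded mult_op_def]
  show "M \<phi> \<in> bop" "F \<in> alg_tensor \<Omega> \<Longrightarrow> blinfun_apply (M \<phi>) (\<iota> F) = \<iota> (\<lambda>z. \<phi> z *\<^sub>C F z)"
    by (rule ext; assumption)+
  assume "\<And>z. z \<in> closure \<Omega> \<Longrightarrow> cmod (\<phi> z) \<le> B"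
  then have "sup_norm \<Omega> \<phi> \<le> B"
    unfolding sup_norm_def using nonempty_domain by (intro cSUP_least) auto
  moreover have "norm (M \<phi>) \<le> sup_norm \<Omega> \<phi>"
    by (rule ext; assumption)
  ultimately show "norm (M \<phi>) \<le> B"
    by simp
qed

lemma mult_op_eqI:
  assumes "\<phi> \<in> A"
    and "\<And>F. F \<in> alg_tensor \<Omega> \<Longrightarrow> blinfun_apply T (\<iota> F) = \<iota> (\<lambda>z. \<phi> z *\<^sub>C F z)"
  shows "M \<phi> = T"
  by (rule blinfun_eqI_dense[OF embed_dense]) (use assms mult_op_embed in auto)

lemma mult_op_mult:
  assumes "\<phi> \<in> A" "\<psi> \<in> A"
  shows "M (\<lambda>z. \<phi> z * \<psi> z) = M \<phi> o\<^sub>L M \<psi>"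
  using assms
  by (intro mult_op_eqI)
     (simp_all add: fun_alg_mult bounded_domain mult_op_embed alg_tensor_mult scaleC_scaleC)

lemma mult_op_shift:
  assumes \<phi>: "\<phi> \<in> A"
  shows "M (\<lambda>z. \<phi> z + c * one z) = M \<phi> + op_scaleC c id_blinfun"
proof (rule mult_op_eqI)
  show "(\<lambda>z. \<phi> z + c * one z) \<in> A"
    by (rule fun_alg_shift[OF bounded_domain \<phi>])
  fix F :: "complex ^ 'n \<Rightarrow> complex ^ 'm"
  assume F: "F \<in> alg_tensor \<Omega>"
  have "(\<phi> z + c * one z) *\<^sub>C F z = \<phi> z *\<^sub>C F z + c *\<^sub>C F z" for z
    using alg_tensor_zero_outside[OF F] by (simp add: indicator_def scaleC_add_left)
  then show "blinfun_apply (M \<phi> + op_scaleC c id_blinfun) (\<iota> F) = \<iota> (\<lambda>z. (\<phi> z + c * one z) *\<^sub>C F z)"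
    using F \<phi> bounded_domain
    by (simp add: blinfun.add_left mult_op_embed embed_add embed_scaleC alg_tensor_mult alg_tensor_scaleC)
qed

lemma polar_isometry:
  assumes z: "z \<in> \<Omega>"
  shows "isometry_op (V z)"
    and "\<exists>Q. positive_op Q \<and> invertible_op Q \<and> adj (E z) = V z o\<^sub>L Q"
proof -
  define R where "R x = \<iota> (\<lambda>w. one w *\<^sub>C x)" for x
  have elem: "(\<lambda>w. one w *\<^sub>C x) \<in> alg_tensor \<Omega>" for x :: "complex ^ 'm"
    using alg_tensor_add_elementary[OF alg_tensor_zero fun_alg_indicator, of \<Omega> x] by simp
  have "linear R"
  proof
    show "R (x + y) = R x + R y" for x y
      using embed_add[OF elem elem, of x y] by (simp add: R_def scaleC_add_right)
    fix r x
    have "R (r *\<^sub>R x) = \<iota> (\<lambda>w. complex_of_real r *\<^sub>C one w *\<^sub>C x)"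
      by (simp add: R_def scaleR_scaleC scaleC_scaleC mult.commute)
    also have "\<dots> = r *\<^sub>R R x"
      by (simp add: embed_scaleC[OF elem] R_def scaleR_scaleC)
    finally show "R (r *\<^sub>R x) = r *\<^sub>R R x" .
  qed
  then obtain C where C: "\<And>x. norm (R x) \<le> C * norm x"
    using linear_bounded by blast
  have "blinfun_apply (E z) (R x) = x" for x
    using z closure_subset[of \<Omega>] by (auto simp: R_def eval_op(2)[OF z elem])
  from polar_decomposition_adj[OF eval_op(1)[OF z] this C]
  have "isometry_op (V z) \<and> (\<exists>Q. positive_op Q \<and> invertible_op Q \<and> adj (E z) = V z o\<^sub>L Q)"
    unfolding polar_isometry_def by (rule someI_ex)
  then show "isometry_op (V z)" "\<exists>Q. positive_op Q \<and> invertible_op Q \<and> adj (E z) = V z o\<^sub>L Q"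
    by blast+
qed

lemma polar_isometry_bop: "z \<in> \<Omega> \<Longrightarrow> V z \<in> bop"
  and polar_isometry_norm_apply: "z \<in> \<Omega> \<Longrightarrow> norm (blinfun_apply (V z) x) = norm x"
  using polar_isometry(1) by (simp_all add: isometry_op_def)

lemma norm_polar_isometry:
  assumes "z \<in> \<Omega>"
  shows "norm (V z) = 1"
proof (rule antisym)
  show "norm (V z) \<le> 1"
    using polar_isometry_norm_apply[OF assms] by (intro norm_blinfun_bound) auto
  obtain x :: "complex ^ 'm" where "norm x = 1"
    using vector_choose_size[of 1] by auto
  then show "1 \<le> norm (V z)"
    using norm_blinfun[of "V z" x] polar_isometry_norm_apply[OF assms, of x] by simp
qed

text \<open>The range of \<open>V z\<close> is that of \<open>adj (E z)\<close>, which consists of eigenvectors of \<open>adj (M \<phi>)\<close>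
  because \<open>E z\<close> intertwines \<open>M \<phi>\<close> with the scalar \<open>\<phi> z\<close>.\<close>

lemma adj_mult_op_polar_isometry:
  assumes z: "z \<in> \<Omega>" and \<phi>: "\<phi> \<in> A"
  shows "adj (M \<phi>) o\<^sub>L V z = op_scaleC (cnj (\<phi> z)) (V z)"
proof -
  have "E z o\<^sub>L M \<phi> = op_scaleC (\<phi> z) (E z)"
    by (rule blinfun_eqI_dense[OF embed_dense])
       (use z \<phi> bounded_domain in \<open>auto simp: mult_op_embed eval_op alg_tensor_mult\<close>)
  then have "adj (M \<phi>) o\<^sub>L adj (E z) = op_scaleC (cnj (\<phi> z)) (adj (E z))"
    using adj_compose[OF eval_op(1)[OF z] mult_op_bop[OF \<phi>]] adj_scaleC[OF eval_op(1)[OF z]] by simp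
  moreover obtain Q Q' where "adj (E z) = V z o\<^sub>L Q" "Q o\<^sub>L Q' = id_blinfun"
    using polar_isometry(2)[OF z] unfolding invertible_op_def by blast
  ultimately have eq: "blinfun_apply (adj (M \<phi>)) (blinfun_apply (V z) (blinfun_apply Q y))
      = cnj (\<phi> z) *\<^sub>C blinfun_apply (V z) (blinfun_apply Q y)" and inv: "blinfun_apply Q (blinfun_apply Q' x) = x" for x y
    by (metis blinfun_apply_blinfun_compose op_scaleC_apply, metis blinfun_apply_blinfun_compose id_blinfun.rep_eq id_apply)
  show ?thesis
    by (rule blinfun_eqI) (use eq[of "blinfun_apply Q' _"] inv in simp)
qed

section \<open>Localization by peak functions\<close>

text \<open>\<open>cinner (M g x) x = g z * (norm x)\<^sup>2\<close> for \<open>x\<close> in the range of \<open>V z\<close>. Thus a contraction \<open>M g\<close> with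
  \<open>g z\<close> close to 1 moves these vectors little, although they are eigenvectors only of its adjoint.\<close>

lemma norm_mult_op_polar_isometry_minus_le:
  assumes z: "z \<in> \<Omega>" and g: "g \<in> A" "\<And>w. w \<in> closure \<Omega> \<Longrightarrow> cmod (g w) \<le> 1"
  shows "norm ((M g o\<^sub>L V z) - V z) \<le> sqrt (2 - 2 * Re (g z))"
proof (rule norm_blinfun_bound)
  have "cmod (g z) \<le> 1"
    using g(2) z closure_subset[of \<Omega>] by blast
  then have Re: "Re (g z) \<le> 1"
    using complex_Re_le_cmod order_trans by blast
  then show "0 \<le> sqrt (2 - 2 * Re (g z))"
    by simp
  fix x
  let ?v = "blinfun_apply (V z) x"
  have "blinfun_apply (adj (M g)) ?v = cnj (g z) *\<^sub>C ?v"
    using adj_mult_op_polar_isometry[OF z g(1), THEN arg_cong, of "\<lambda>T. blinfun_apply T x"] by simp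
  then have "cinner (blinfun_apply (M g) ?v) ?v = g z * (norm x)\<^sup>2"
    using cinner_adj_right[OF mult_op_bop[OF g(1)], of ?v ?v] polar_isometry_norm_apply[OF z, of x]
    by (simp add: cinner_simps cinner_self)
  then have "Re (cinner (blinfun_apply (M g) ?v) ?v) = Re (g z) * (norm x)\<^sup>2"
    by simp
  moreover have "norm (blinfun_apply (M g) ?v) \<le> norm x"
    using norm_blinfun[of "M g" ?v] mult_right_mono[OF norm_mult_op_le[OF g], of "norm ?v"]
      polar_isometry_norm_apply[OF z, of x] by simp
  then have "(norm (blinfun_apply (M g) ?v))\<^sup>2 \<le> (norm x)\<^sup>2"
    by (intro power_mono) auto
  ultimately have "(norm (blinfun_apply (M g) ?v - ?v))\<^sup>2 \<le> (2 - 2 * Re (g z)) * (norm x)\<^sup>2"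
    unfolding norm_diff_square using polar_isometry_norm_apply[OF z, of x] by (simp add: algebra_simps)
  also have "\<dots> = (sqrt (2 - 2 * Re (g z)) * norm x)\<^sup>2"
    using Re by (simp add: power_mult_distrib)
  finally have "norm (blinfun_apply (M g) ?v - ?v) \<le> sqrt (2 - 2 * Re (g z)) * norm x"
    by (rule power2_le_imp_le) (use Re in simp)
  then show "norm (blinfun_apply ((M g o\<^sub>L V z) - V z) x) \<le> sqrt (2 - 2 * Re (g z)) * norm x"
    by (simp add: blinfun.diff_left)
qed

text \<open>Split \<open>M \<psi> (V z)\<close> into \<open>M (\<psi> g) (V z)\<close>, which is small because \<open>\<psi> g\<close> is small everywhere, and
  \<open>M \<psi>\<close> applied to the difference of \<open>V z\<close> and \<open>M g (V z)\<close>.\<close>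

lemma norm_mult_op_polar_isometry_le:
  assumes z: "z \<in> \<Omega>" and g: "g \<in> A" "\<And>w. w \<in> closure \<Omega> \<Longrightarrow> cmod (g w) \<le> 1"
    and \<psi>: "\<psi> \<in> A" "\<And>w. w \<in> closure \<Omega> \<Longrightarrow> cmod (\<psi> w) \<le> K"
    and \<psi>g: "\<And>w. w \<in> closure \<Omega> \<Longrightarrow> cmod (\<psi> w * g w) \<le> \<epsilon>"
  shows "norm (M \<psi> o\<^sub>L V z) \<le> K * sqrt (2 - 2 * Re (g z)) + \<epsilon>"
proof -
  have K: "0 \<le> K"
    using \<psi>(2)[of z] z closure_subset[of \<Omega>] by (meson norm_ge_zero order_trans subsetD)
  have eq: "M \<psi> o\<^sub>L V z = (M (\<lambda>w. \<psi> w * g w) o\<^sub>L V z) - (M \<psi> o\<^sub>L ((M g o\<^sub>L V z) - V z))"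
    unfolding mult_op_mult[OF \<psi>(1) g(1)]
    by (intro blinfun_eqI) (simp add: blinfun.diff_left blinfun.diff_right)
  have "norm (M \<psi> o\<^sub>L V z)
      \<le> norm (M (\<lambda>w. \<psi> w * g w) o\<^sub>L V z) + norm (M \<psi> o\<^sub>L ((M g o\<^sub>L V z) - V z))"
    by (subst eq) (rule norm_triangle_ineq4)
  moreover have "norm (M (\<lambda>w. \<psi> w * g w) o\<^sub>L V z) \<le> \<epsilon>"
    using norm_blinfun_compose[of "M (\<lambda>w. \<psi> w * g w)" "V z"] norm_polar_isometry[OF z]
      norm_mult_op_le[OF fun_alg_mult[OF bounded_domain \<psi>(1) g(1)] \<psi>g] by simp
  moreover have "norm (M \<psi> o\<^sub>L ((M g o\<^sub>L V z) - V z)) \<le> K * sqrt (2 - 2 * Re (g z))"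
    by (rule order_trans[OF norm_blinfun_compose])
       (intro mult_mono norm_mult_op_le[OF \<psi>] norm_mult_op_polar_isometry_minus_le[OF z g] K norm_ge_zero)
  ultimately show ?thesis
    by simp
qed

text \<open>High powers of a function that peaks inside the neighbourhood of \<open>\<alpha>\<close> given by \<open>X\<close> and \<open>e\<close> are
  negligible off that neighbourhood, uniformly by compactness of \<open>closure \<Omega>\<close>.\<close>

lemma peak_localization:
  assumes X: "finite X" "X \<subseteq> A" and e: "e > 0"
    and f: "f \<in> A" "\<And>z. z \<in> closure \<Omega> \<Longrightarrow> cmod (f z) \<le> 1"
    and peak: "\<And>z \<psi>. z \<in> closure \<Omega> \<Longrightarrow> \<psi> \<in> X \<Longrightarrow> e / 2 \<le> cmod (\<psi> z - \<alpha> \<psi>) \<Longrightarrow> cmod (f z) < 1"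
  obtains N \<delta> where "\<delta> > 0" "\<And>z \<psi>. z \<in> \<Omega> \<Longrightarrow> cmod (f z ^ N - 1) < \<delta> \<Longrightarrow> \<psi> \<in> X \<Longrightarrow>
    norm ((M \<psi> o\<^sub>L V z) - op_scaleC (\<alpha> \<psi>) (V z)) < e"
proof -
  have "\<exists>B>0. \<forall>z\<in>closure \<Omega>. cmod (\<psi> z) \<le> B" if "\<psi> \<in> X" for \<psi>
    using fun_alg_bound[OF bounded_domain, of \<psi>] X(2) that by (metis subsetD)
  then obtain B where B: "\<And>\<psi>. \<psi> \<in> X \<Longrightarrow> B \<psi> > 0"
    "\<And>\<psi> z. \<psi> \<in> X \<Longrightarrow> z \<in> closure \<Omega> \<Longrightarrow> cmod (\<psi> z) \<le> B \<psi>"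
    by metis
  define K where "K = 1 + (\<Sum>\<psi>\<in>X. B \<psi> + cmod (\<alpha> \<psi>))"
  have nonneg: "0 \<le> B \<psi> + cmod (\<alpha> \<psi>)" if "\<psi> \<in> X" for \<psi>
    using B(1)[OF that] by (simp add: less_imp_le)
  have K: "K > 0"
    using sum_nonneg[of X "\<lambda>\<psi>. B \<psi> + cmod (\<alpha> \<psi>)"] nonneg unfolding K_def by force
  have \<psi>K: "cmod (\<psi> z - \<alpha> \<psi>) \<le> K" if "\<psi> \<in> X" "z \<in> closure \<Omega>" for \<psi> z
  proof -
    have "B \<psi> + cmod (\<alpha> \<psi>) \<le> K"
      using member_le_sum[of \<psi> X "\<lambda>\<psi>. B \<psi> + cmod (\<alpha> \<psi>)"] nonneg that(1) X(1) by (simp add: K_def)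
    then show ?thesis
      using norm_triangle_ineq4[of "\<psi> z" "\<alpha> \<psi>"] B(2)[OF that] by linarith
  qed
  define L where "L = (\<Union>\<psi>\<in>X. {z \<in> closure \<Omega>. e / 2 \<le> cmod (\<psi> z - \<alpha> \<psi>)})"
  have "compact {z \<in> closure \<Omega>. e / 2 \<le> cmod (\<psi> z - \<alpha> \<psi>)}" if "\<psi> \<in> X" for \<psi>
  proof -
    have "continuous_on (closure \<Omega>) (\<lambda>z. cmod (\<psi> z - \<alpha> \<psi>))"
      using X(2) that by (intro continuous_intros fun_alg_continuous_on) auto
    then have "closed (closure \<Omega> \<inter> (\<lambda>z. cmod (\<psi> z - \<alpha> \<psi>)) -` {e / 2..})"
      by (rule continuous_closed_preimage) simp_all
    moreover have "{z \<in> closure \<Omega>. e / 2 \<le> cmod (\<psi> z - \<alpha> \<psi>)}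
        = closure \<Omega> \<inter> (\<lambda>z. cmod (\<psi> z - \<alpha> \<psi>)) -` {e / 2..}"
      by auto
    moreover have "bounded {z \<in> closure \<Omega>. e / 2 \<le> cmod (\<psi> z - \<alpha> \<psi>)}"
      using bounded_closure[OF bounded_domain] by (rule bounded_subset) auto
    ultimately show ?thesis
      by (simp add: compact_eq_bounded_closed)
  qed
  then have L: "compact L" "L \<subseteq> closure \<Omega>"
    unfolding L_def using X(1) by auto
  obtain r where r: "0 \<le> r" "r < 1" "\<And>z. z \<in> L \<Longrightarrow> cmod (f z) \<le> r"
  proof (cases "L = {}")
    case True
    then show thesis
      by (intro that[of 0]) auto
  next
    case False
    have "continuous_on L (\<lambda>z. cmod (f z))"
      by (intro continuous_on_norm continuous_on_subset[OF fun_alg_continuous_on[OF f(1)] L(2)])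
    then obtain z1 where "z1 \<in> L" "\<forall>z\<in>L. cmod (f z) \<le> cmod (f z1)"
      using continuous_attains_sup[OF L(1) False] by blast
    then show thesis
      using peak by (intro that[of "cmod (f z1)"]) (auto simp: L_def)
  qed
  have "(\<lambda>n. K * r ^ n) \<longlonglongrightarrow> K * 0"
    using r by (intro tendsto_intros LIMSEQ_realpow_zero) auto
  then have "\<forall>\<^sub>F n in sequentially. K * r ^ n < e / 2"
    using e by (intro order_tendstoD(2)) auto
  then obtain N where N: "K * r ^ N < e / 2"
    by (auto simp: eventually_sequentially)
  define g where "g z = one z * f z ^ N" for z
  have g: "g \<in> A"
    unfolding g_def by (rule fun_alg_power[OF bounded_domain f(1)])
  have g1: "cmod (g z) \<le> 1" if "z \<in> closure \<Omega>" for z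
    using f(2)[OF that] that by (simp add: g_def norm_power power_le_one)
  \<comment> \<open>Chosen so that \<open>K * sqrt (2 * \<delta>) = e / 2\<close>.\<close>
  define \<delta> where "\<delta> = (e / (2 * K))\<^sup>2 / 2"
  show thesis
  proof (rule that[of \<delta> N])
    show "\<delta> > 0"
      using e K by (simp add: \<delta>_def)
    fix z \<psi> assume z: "z \<in> \<Omega>" and fz: "cmod (f z ^ N - 1) < \<delta>" and \<psi>: "\<psi> \<in> X"
    define \<psi>' where "\<psi>' w = \<psi> w + (- \<alpha> \<psi>) * one w" for w
    have \<psi>': "\<psi>' \<in> A"
      unfolding \<psi>'_def using \<psi> X(2) by (intro fun_alg_shift bounded_domain) auto
    have \<psi>'w: "\<psi>' w = \<psi> w - \<alpha> \<psi>" if "w \<in> closure \<Omega>" for w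
      using that by (simp add: \<psi>'_def)
    have "cmod (\<psi>' w * g w) \<le> e / 2" if w: "w \<in> closure \<Omega>" for w
    proof (cases "w \<in> L")
      case True
      have "cmod (\<psi>' w * g w) = cmod (\<psi> w - \<alpha> \<psi>) * cmod (f w) ^ N"
        using w by (simp add: \<psi>'w g_def norm_mult norm_power)
      also have "\<dots> \<le> K * r ^ N"
        using \<psi>K[OF \<psi> w] r(3)[OF True] K by (intro mult_mono power_mono) auto
      finally show ?thesis
        using N by simp
    next
      case False
      then have "cmod (\<psi>' w) * cmod (g w) \<le> e / 2 * 1"
        using w \<psi> e g1[OF w] by (intro mult_mono) (auto simp: L_def \<psi>'w)
      then show ?thesis
        by (simp add: norm_mult)
    qed
    then have "norm (M \<psi>' o\<^sub>L V z) \<le> K * sqrt (2 - 2 * Re (g z)) + e / 2"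
      by (intro norm_mult_op_polar_isometry_le[OF z g g1 \<psi>']) (use \<psi>K[OF \<psi>] \<psi>'w in auto)
    moreover have "K * sqrt (2 - 2 * Re (g z)) < e / 2"
    proof -
      have "g z = f z ^ N"
        using z closure_subset[of \<Omega>] by (auto simp: g_def)
      then have "1 - Re (g z) < \<delta>"
        using fz abs_Re_le_cmod[of "f z ^ N - 1"] by simp
      then have "2 - 2 * Re (g z) < (e / (2 * K))\<^sup>2"
        unfolding \<delta>_def by linarith
      then have "sqrt (2 - 2 * Re (g z)) < e / (2 * K)"
        using e K by (intro real_less_lsqrt) auto
      then show ?thesis
        using K by (simp add: field_simps)
    qed
    moreover have "(M \<psi> o\<^sub>L V z) - op_scaleC (\<alpha> \<psi>) (V z) = M \<psi>' o\<^sub>L V z"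
      unfolding \<psi>'_def using mult_op_shift[of \<psi> "- \<alpha> \<psi>"] \<psi> X(2)
      by (intro blinfun_eqI) (auto simp: blinfun.diff_left blinfun.add_left scaleC_minus_left)
    ultimately show "norm ((M \<psi> o\<^sub>L V z) - op_scaleC (\<alpha> \<psi>) (V z)) < e"
      by simp
  qed
qed

text \<open>The coarsest filter on \<open>\<Omega>\<close> along which every multiplication operator \<open>M \<psi>\<close> acts asymptotically as
  the scalar \<open>\<alpha> \<psi>\<close> on the ranges of the isometries \<open>V z\<close>.\<close>

definition localizing_filter :: "((complex ^ 'n \<Rightarrow> complex) \<Rightarrow> complex) \<Rightarrow> (complex ^ 'n) filter"
  where "localizing_filter \<alpha> = (INF (X, e) \<in> {X. finite X \<and> X \<subseteq> A} \<times> {0<..}.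
    principal {z \<in> \<Omega>. \<forall>\<psi>\<in>X. norm ((M \<psi> o\<^sub>L V z) - op_scaleC (\<alpha> \<psi>) (V z)) < e})"

lemma eventually_localizing_filter:
  assumes "finite X" "X \<subseteq> A" "e > 0"
  shows "\<forall>\<^sub>F z in localizing_filter \<alpha>. z \<in> \<Omega> \<and>
    (\<forall>\<psi>\<in>X. norm ((M \<psi> o\<^sub>L V z) - op_scaleC (\<alpha> \<psi>) (V z)) < e)"
  unfolding localizing_filter_def
  by (rule eventually_INF1[of "(X, e)"]) (use assms in \<open>auto simp: eventually_principal\<close>)

lemma localizing_filter_in_domain: "\<forall>\<^sub>F z in localizing_filter \<alpha>. z \<in> \<Omega>"
  using eventually_localizing_filter[of "{}" 1 \<alpha>] by simp

text \<open>The points of \<open>\<Omega>\<close> that witness nontriviality approach a peak point \<open>z0\<close> in \<open>closure \<Omega>\<close>, which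
  depends on the neighbourhood of \<open>\<alpha>\<close> and may lie outside \<open>\<Omega>\<close>.\<close>

lemma localizing_filter_nontrivial:
  assumes \<alpha>: "\<alpha> \<in> silov_boundary A"
  shows "localizing_filter \<alpha> \<noteq> bot"
proof -
  let ?P = "\<lambda>(X, e). {z \<in> \<Omega>. \<forall>\<psi>\<in>X. norm ((M \<psi> o\<^sub>L V z) - op_scaleC (\<alpha> \<psi>) (V z)) < e}"
  let ?I = "{X. finite X \<and> X \<subseteq> A} \<times> {0::real<..}"
  have eq: "localizing_filter \<alpha> = (INF p\<in>?I. principal (?P p))"
    unfolding localizing_filter_def by (intro INF_cong) auto
  have ne: "?P (X, e) \<noteq> {}" if X: "finite X" "X \<subseteq> A" and e: "e > 0" for X e
  proof -
    have "e / 2 > 0"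
      using e by simp
    obtain f z0 where f: "f \<in> A" "z0 \<in> closure \<Omega>" "f z0 = 1"
      "\<And>z. z \<in> closure \<Omega> \<Longrightarrow> cmod (f z) \<le> 1"
      "\<And>z \<psi>. z \<in> closure \<Omega> \<Longrightarrow> \<psi> \<in> X \<Longrightarrow> e / 2 \<le> cmod (\<psi> z - \<alpha> \<psi>) \<Longrightarrow> cmod (f z) < 1"
      by (rule silov_boundary_peak_function[OF bounded_domain nonempty_domain \<alpha> X \<open>e / 2 > 0\<close>])
         (rule that)
    obtain N \<delta> where N: "\<delta> > 0" "\<And>z \<psi>. z \<in> \<Omega> \<Longrightarrow> cmod (f z ^ N - 1) < \<delta> \<Longrightarrow> \<psi> \<in> X \<Longrightarrow>
        norm ((M \<psi> o\<^sub>L V z) - op_scaleC (\<alpha> \<psi>) (V z)) < e"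
      by (rule peak_localization[where \<alpha> = \<alpha>, OF X e f(1,4,5)]) (assumption+, rule that)
    obtain Z where Z: "\<And>n. Z n \<in> \<Omega>" "Z \<longlonglongrightarrow> z0"
      using f(2) unfolding closure_sequential by blast
    have "(\<lambda>n. f (Z n)) \<longlonglongrightarrow> f z0"
      using continuous_on_tendsto_compose[OF fun_alg_continuous_on[OF f(1)] Z(2) f(2)] Z(1)
        closure_subset[of \<Omega>] by (simp add: subset_iff)
    then have "(\<lambda>n. f (Z n) ^ N) \<longlonglongrightarrow> f z0 ^ N"
      by (rule tendsto_power)
    then have "\<forall>\<^sub>F n in sequentially. dist (f (Z n) ^ N) 1 < \<delta>"
      using N(1) f(3) by (auto dest: tendstoD)
    then obtain n where "dist (f (Z n) ^ N) 1 < \<delta>"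
      by (auto simp: eventually_sequentially)
    then show ?thesis
      using N(2)[OF Z(1)[of n]] Z(1)[of n] by (auto simp: dist_norm)
  qed
  have "(INF p\<in>?I. principal (?P p)) = bot \<longleftrightarrow> (\<exists>p\<in>?I. principal (?P p) = bot)"
  proof (rule INF_filter_bot_base)
    fix p q assume "p \<in> ?I" "q \<in> ?I"
    then show "\<exists>k\<in>?I. principal (?P k) \<le> inf (principal (?P p)) (principal (?P q))"
      by (intro bexI[of _ "(fst p \<union> fst q, min (snd p) (snd q))"]) auto
  qed
  moreover have "principal (?P p) \<noteq> bot" if "p \<in> ?I" for p
    using ne[of "fst p" "snd p"] that by (auto simp: principal_eq_bot_iff)
  ultimately show ?thesis
    unfolding eq by blast
qed

text \<open>At a p-point the peak value 1 is taken at \<open>\<alpha>\<close> itself, so \<open>f z\<close> tends to 1 whenever \<open>z\<close> tends to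
  \<open>\<alpha>\<close>.\<close>

lemma tends_to_char_le_localizing_filter:
  assumes p: "p_point A \<alpha>"
  shows "tends_to_char \<Omega> \<alpha> \<le> localizing_filter \<alpha>"
  unfolding localizing_filter_def
proof (rule INF_greatest)
  fix q :: "(complex ^ 'n \<Rightarrow> complex) set \<times> real"
  assume "q \<in> {X. finite X \<and> X \<subseteq> A} \<times> {0<..}"
  then obtain X e where q: "q = (X, e)" and X: "finite X" "X \<subseteq> A" and e: "e > 0" "e / 2 > 0"
    by auto
  obtain f where f: "f \<in> A" "\<alpha> f = 1" "\<And>z. z \<in> closure \<Omega> \<Longrightarrow> cmod (f z) \<le> 1"
    "\<And>z \<psi>. z \<in> closure \<Omega> \<Longrightarrow> \<psi> \<in> X \<Longrightarrow> e / 2 \<le> cmod (\<psi> z - \<alpha> \<psi>) \<Longrightarrow> cmod (f z) < 1"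
    by (rule p_point_peak_function[OF bounded_domain p X e(2)]) (rule that)
  obtain N \<delta> where N: "\<delta> > 0" "\<And>z \<psi>. z \<in> \<Omega> \<Longrightarrow> cmod (f z ^ N - 1) < \<delta> \<Longrightarrow> \<psi> \<in> X \<Longrightarrow>
      norm ((M \<psi> o\<^sub>L V z) - op_scaleC (\<alpha> \<psi>) (V z)) < e"
    by (rule peak_localization[where \<alpha> = \<alpha>, OF X e(1) f(1,3,4)]) (assumption+, rule that)
  have "open {\<beta> :: (complex ^ 'n \<Rightarrow> complex) \<Rightarrow> complex. cmod (\<beta> f ^ N - 1) < \<delta>}"
    by (intro open_Collect_less continuous_intros continuous_on_product_coordinates)
  then have "\<forall>\<^sub>F \<beta> in nhds \<alpha>. cmod (\<beta> f ^ N - 1) < \<delta>"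
    using f(2) N(1) by (auto simp: eventually_nhds)
  then have "\<forall>\<^sub>F z in filtercomap (point_char A) (nhds \<alpha>). cmod (point_char A z f ^ N - 1) < \<delta>"
    by (rule eventually_filtercomapI)
  then have "\<forall>\<^sub>F z in tends_to_char \<Omega> \<alpha>. z \<in> \<Omega> \<and> cmod (f z ^ N - 1) < \<delta>"
    unfolding tends_to_char_def eventually_inf_principal
    by eventually_elim (use f(1) in \<open>simp add: point_char_def\<close>)
  then have "\<forall>\<^sub>F z in tends_to_char \<Omega> \<alpha>. z \<in> \<Omega> \<and>
      (\<forall>\<psi>\<in>X. norm ((M \<psi> o\<^sub>L V z) - op_scaleC (\<alpha> \<psi>) (V z)) < e)"
    by eventually_elim (use N(2) in blast)
  then show "tends_to_char \<Omega> \<alpha> \<le> (case q of (X, e) \<Rightarrow>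
      principal {z \<in> \<Omega>. \<forall>\<psi>\<in>X. norm ((M \<psi> o\<^sub>L V z) - op_scaleC (\<alpha> \<psi>) (V z)) < e})"
    by (simp add: q le_principal)
qed

section \<open>The symbol map\<close>

text \<open>The adjoint half follows from the other one: \<open>adj (M \<psi>)\<close> acts on the range of \<open>V z\<close> exactly as \<open>cnj (\<psi> z)\<close>,
  and compression by \<open>V z\<close> bounds \<open>cmod (\<psi> z - \<alpha> \<psi>)\<close> by the norm in the other half.\<close>

lemma mult_op_asymptotic_eigenvalue:
  assumes \<psi>: "\<psi> \<in> A"
  shows "asymptotic_eigenvalue (localizing_filter \<alpha>) V (M \<psi>) (\<alpha> \<psi>)"
proof -
  let ?F = "localizing_filter \<alpha>"
  have lim: "((\<lambda>z. (M \<psi> o\<^sub>L V z) - op_scaleC (\<alpha> \<psi>) (V z)) \<longlongrightarrow> 0) ?F"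
  proof (rule tendstoI)
    fix e :: real assume "e > 0"
    then have "\<forall>\<^sub>F z in ?F. z \<in> \<Omega> \<and> (\<forall>\<phi>\<in>{\<psi>}. norm ((M \<phi> o\<^sub>L V z) - op_scaleC (\<alpha> \<phi>) (V z)) < e)"
      using \<psi> by (intro eventually_localizing_filter) auto
    then show "\<forall>\<^sub>F z in ?F. dist ((M \<psi> o\<^sub>L V z) - op_scaleC (\<alpha> \<psi>) (V z)) 0 < e"
      by eventually_elim simp
  qed
  moreover have "((\<lambda>z. (adj (M \<psi>) o\<^sub>L V z) - op_scaleC (cnj (\<alpha> \<psi>)) (V z)) \<longlongrightarrow> 0) ?F"
  proof (rule Lim_null_comparison[OF _ tendsto_norm_zero[OF lim]])
    show "\<forall>\<^sub>F z in ?F. norm ((adj (M \<psi>) o\<^sub>L V z) - op_scaleC (cnj (\<alpha> \<psi>)) (V z))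
        \<le> norm ((M \<psi> o\<^sub>L V z) - op_scaleC (\<alpha> \<psi>) (V z))"
      using localizing_filter_in_domain
    proof eventually_elim
      case (elim z)
      let ?T = "M \<psi> - op_scaleC (\<alpha> \<psi>) id_blinfun"
      have T: "?T \<in> bop" "?T o\<^sub>L V z \<in> bop"
        using elim \<psi> by (auto intro!: bop_diff bop_compose bop_scaleC mult_op_bop polar_isometry_bop)
      have eig: "blinfun_apply (adj ?T) (blinfun_apply (V z) x) = cnj (\<psi> z - \<alpha> \<psi>) *\<^sub>C blinfun_apply (V z) x" for x
        using adj_mult_op_polar_isometry[OF elim \<psi>, THEN arg_cong, of "\<lambda>T. blinfun_apply T x"]
          adj_eqI[of id_blinfun "id_blinfun :: 'r \<Rightarrow>\<^sub>L 'r"]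
        by (simp add: adj_diff mult_op_bop[OF \<psi>] bop_scaleC adj_scaleC blinfun.diff_left scaleC_diff_left)
      have inv: "blinfun_apply (adj (V z)) (blinfun_apply (V z) x) = x" for x
        using isometry_adj_compose[OF polar_isometry(1)[OF elim], THEN arg_cong, of "\<lambda>T. blinfun_apply T x"]
        by simp
      have "op_scaleC (cnj (\<psi> z - \<alpha> \<psi>)) id_blinfun = adj (?T o\<^sub>L V z) o\<^sub>L V z"
        unfolding adj_compose[OF T(1) polar_isometry_bop[OF elim]]
        by (rule blinfun_eqI)
           (simp add: eig bopD[OF adj_bop[OF polar_isometry_bop[OF elim]]] inv del: complex_cnj_diff)
      then have "cmod (\<psi> z - \<alpha> \<psi>) * norm (id_blinfun :: (complex ^ 'm) \<Rightarrow>\<^sub>L (complex ^ 'm))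
          \<le> norm (?T o\<^sub>L V z) * norm (V z)"
        using norm_op_scaleC[of "cnj (\<psi> z - \<alpha> \<psi>)" "id_blinfun :: (complex ^ 'm) \<Rightarrow>\<^sub>L (complex ^ 'm)"]
          norm_blinfun_compose[of "adj (?T o\<^sub>L V z)" "V z"] norm_adj[OF T(2)]
        by (simp del: complex_cnj_diff)
      moreover have "?T o\<^sub>L V z = (M \<psi> o\<^sub>L V z) - op_scaleC (\<alpha> \<psi>) (V z)"
        by (rule blinfun_eqI) (simp add: blinfun.diff_left)
      moreover have "(adj (M \<psi>) o\<^sub>L V z) - op_scaleC (cnj (\<alpha> \<psi>)) (V z) = op_scaleC (cnj (\<psi> z - \<alpha> \<psi>)) (V z)"
        unfolding adj_mult_op_polar_isometry[OF elim \<psi>]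
        by (rule blinfun_eqI) (simp add: blinfun.diff_left scaleC_diff_left)
      ultimately show ?case
        using norm_polar_isometry[OF elim] by (simp add: norm_op_scaleC norm_blinfun_id del: complex_cnj_diff)
    qed
  qed
  ultimately show ?thesis
    by (simp add: asymptotic_eigenvalue_def)
qed

text \<open>The symbol of \<open>T\<close> at \<open>\<alpha>\<close> is its asymptotic eigenvalue along the localizing filter. The operators
  that have a continuous symbol form a C*-algebra, and it contains the generators, whose symbols are
  their Gelfand transforms. Uniqueness of asymptotic eigenvalues makes the symbol a *-homomorphism.\<close>

lemma toeplitz_symbol:
  obtains \<Phi> where "cstar_subalgebra (toeplitz_alg \<Omega> \<iota>)"
    "star_hom_C (toeplitz_alg \<Omega> \<iota>) (silov_boundary A) \<Phi>"
    "\<And>T \<alpha>. T \<in> toeplitz_alg \<Omega> \<iota> \<Longrightarrow> \<alpha> \<in> silov_boundary A \<Longrightarrow>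
      asymptotic_eigenvalue (localizing_filter \<alpha>) V T (\<Phi> T \<alpha>)"
    "\<And>S T \<alpha>. S \<in> toeplitz_alg \<Omega> \<iota> \<Longrightarrow> T \<in> toeplitz_alg \<Omega> \<iota> \<Longrightarrow> \<alpha> \<in> silov_boundary A \<Longrightarrow>
      dist (\<Phi> S \<alpha>) (\<Phi> T \<alpha>) \<le> dist S T"
proof -
  let ?F = localizing_filter and ?K = "silov_boundary A" and ?T = "toeplitz_alg \<Omega> \<iota>"
  let ?ev = "\<lambda>\<alpha>. asymptotic_eigenvalue (?F \<alpha>) V"
  let ?S = "{T \<in> bop. \<exists>s. continuous_on ?K s \<and> (\<forall>\<alpha>\<in>?K. ?ev \<alpha> T (s \<alpha>))}"
  have F: "?F \<alpha> \<noteq> bot" "\<forall>\<^sub>F z in ?F \<alpha>. norm (V z) = 1" if "\<alpha> \<in> ?K" for \<alpha>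
    using localizing_filter_nontrivial[OF that] localizing_filter_in_domain[of \<alpha>]
    by (auto elim: eventually_mono simp: norm_polar_isometry)
  have S: "cstar_subalgebra ?S"
    by (rule cstar_subalgebra_continuous_symbol[OF F])
  have gen: "M ` A \<subseteq> ?S"
  proof safe
    fix \<psi> assume "\<psi> \<in> A"
    then show "M \<psi> \<in> bop" "\<exists>s. continuous_on ?K s \<and> (\<forall>\<alpha>\<in>?K. ?ev \<alpha> (M \<psi>) (s \<alpha>))"
      by (auto intro!: exI[of _ "\<lambda>\<alpha>. \<alpha> \<psi>"] mult_op_bop mult_op_asymptotic_eigenvalue
          intro: continuous_on_subset[OF continuous_on_product_coordinates])
  qed
  have T: "cstar_subalgebra ?T"
    unfolding toeplitz_alg_def by (rule cstar_subalgebra_generated[OF S gen])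
  have sub: "?T \<subseteq> ?S"
    unfolding toeplitz_alg_def by (rule cstar_generated_minimal[OF S gen])
  then have bop: "X \<in> bop" if "X \<in> ?T" for X
    using that by blast
  have "\<exists>s. continuous_on ?K s \<and> (\<forall>\<alpha>\<in>?K. ?ev \<alpha> X (s \<alpha>))" if "X \<in> ?T" for X
    using sub that by blast
  then obtain \<Phi> where \<Phi>: "\<And>X. X \<in> ?T \<Longrightarrow> continuous_on ?K (\<Phi> X)"
    "\<And>X \<alpha>. X \<in> ?T \<Longrightarrow> \<alpha> \<in> ?K \<Longrightarrow> ?ev \<alpha> X (\<Phi> X \<alpha>)"
    by metis
  have val: "\<Phi> X \<alpha> = c" if "X \<in> ?T" "\<alpha> \<in> ?K" "?ev \<alpha> X c" for X \<alpha> c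
    by (rule asymptotic_eigenvalue_unique[OF F[OF that(2)] bop[OF that(1)] \<Phi>(2)[OF that(1,2)] that(3)])
  have clo: "X + Y \<in> ?T" "X o\<^sub>L Y \<in> ?T" "op_scaleC c X \<in> ?T" "adj X \<in> ?T"
    if "X \<in> ?T" "Y \<in> ?T" for X Y c
    using T that unfolding cstar_subalgebra_def by simp_all
  have "star_hom_C ?T ?K \<Phi>"
    unfolding star_hom_C_def
    by (intro conjI ballI allI val)
       (auto intro: \<Phi> clo bop asymptotic_eigenvalue_add asymptotic_eigenvalue_scaleC
         asymptotic_eigenvalue_compose asymptotic_eigenvalue_adj)
  moreover have "dist (\<Phi> X \<alpha>) (\<Phi> Y \<alpha>) \<le> dist X Y" if "X \<in> ?T" "Y \<in> ?T" "\<alpha> \<in> ?K" for X Y \<alpha>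
    by (rule asymptotic_eigenvalue_dist[OF F[OF that(3)]]) (use that \<Phi> bop in auto)
  ultimately show thesis
    using that[OF T _ \<Phi>(2)] by blast
qed

text \<open>\<open>\<Gamma>(T)(z) - c\<close> is the compression \<open>V z\<^sup>* (T V z - c V z)\<close>.\<close>

lemma berezin_tendsto:
  assumes p: "p_point A \<alpha>" and ev: "asymptotic_eigenvalue (localizing_filter \<alpha>) V T c"
  shows "(berezin \<Omega> \<iota> T \<longlongrightarrow> op_scaleC c id_blinfun) (tends_to_char \<Omega> \<alpha>)"
proof (rule tendsto_mono[OF tends_to_char_le_localizing_filter[OF p]])
  let ?F = "localizing_filter \<alpha>"
  have lim: "((\<lambda>z. (T o\<^sub>L V z) - op_scaleC c (V z)) \<longlongrightarrow> 0) ?F"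
    using ev by (simp add: asymptotic_eigenvalue_def)
  have "\<forall>\<^sub>F z in ?F. norm (berezin \<Omega> \<iota> T z - op_scaleC c id_blinfun)
      \<le> norm ((T o\<^sub>L V z) - op_scaleC c (V z))"
    using localizing_filter_in_domain
  proof eventually_elim
    case (elim z)
    have V: "V z \<in> bop"
      by (rule polar_isometry_bop[OF elim])
    have "blinfun_apply (adj (V z)) (blinfun_apply (V z) x) = x" for x
      using isometry_adj_compose[OF polar_isometry(1)[OF elim], THEN arg_cong, of "\<lambda>T. blinfun_apply T x"]
      by simp
    then have "berezin \<Omega> \<iota> T z - op_scaleC c id_blinfun = adj (V z) o\<^sub>L ((T o\<^sub>L V z) - op_scaleC c (V z))"
      using adj_bop[OF V] unfolding berezin_def
      by (intro blinfun_eqI) (simp add: blinfun.diff_left blinfun.diff_right bopD)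
    then show ?case
      using norm_blinfun_compose[of "adj (V z)" "(T o\<^sub>L V z) - op_scaleC c (V z)"] norm_adj[OF V]
        norm_polar_isometry[OF elim] by simp
  qed
  then have "((\<lambda>z. berezin \<Omega> \<iota> T z - op_scaleC c id_blinfun) \<longlongrightarrow> 0) ?F"
    by (rule Lim_null_comparison[OF _ tendsto_norm_zero[OF lim]])
  then show "(berezin \<Omega> \<iota> T \<longlongrightarrow> op_scaleC c id_blinfun) ?F"
    by (simp add: LIM_zero_iff)
qed

end

theorem theorem3p3:
  fixes \<Omega> :: "(complex ^ 'n) set"
    and \<iota> :: "(complex ^ 'n \<Rightarrow> complex ^ 'm) \<Rightarrow> 'r::chilbert_space"
  assumes "open \<Omega>" and "connected \<Omega>" and "\<Omega> \<noteq> {}" and "bounded \<Omega>"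
    and "quasi_free \<Omega> \<iota>"
  shows "\<exists>\<Gamma>'. star_hom_C (toeplitz_alg \<Omega> \<iota>) (silov_boundary (fun_alg \<Omega>)) \<Gamma>' \<and>
    (\<forall>\<alpha>\<in>silov_boundary (fun_alg \<Omega>). p_point (fun_alg \<Omega>) \<alpha> \<longrightarrow>
      (\<forall>T\<in>toeplitz_alg \<Omega> \<iota>.
        (berezin \<Omega> \<iota> T \<longlongrightarrow> op_scaleC (\<Gamma>' T \<alpha>) id_blinfun) (tends_to_char \<Omega> \<alpha>))) \<and>
    closed_ideal (toeplitz_alg \<Omega> \<iota>)
      (null_space (toeplitz_alg \<Omega> \<iota>) (silov_boundary (fun_alg \<Omega>)) \<Gamma>') \<and>
    commutator_ideal (toeplitz_alg \<Omega> \<iota>)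
      \<subseteq> null_space (toeplitz_alg \<Omega> \<iota>) (silov_boundary (fun_alg \<Omega>)) \<Gamma>'"
proof -
  interpret quasi_free_module \<Omega> \<iota>
    using assms by unfold_locales
  obtain \<Phi> where \<Phi>: "cstar_subalgebra (toeplitz_alg \<Omega> \<iota>)"
    "star_hom_C (toeplitz_alg \<Omega> \<iota>) (silov_boundary A) \<Phi>"
    "\<And>T \<alpha>. T \<in> toeplitz_alg \<Omega> \<iota> \<Longrightarrow> \<alpha> \<in> silov_boundary A \<Longrightarrow>
      asymptotic_eigenvalue (localizing_filter \<alpha>) V T (\<Phi> T \<alpha>)"
    "\<And>S T \<alpha>. S \<in> toeplitz_alg \<Omega> \<iota> \<Longrightarrow> T \<in> toeplitz_alg \<Omega> \<iota> \<Longrightarrow> \<alpha> \<in> silov_boundary A \<Longrightarrow>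
      dist (\<Phi> S \<alpha>) (\<Phi> T \<alpha>) \<le> dist S T"
    by (rule toeplitz_symbol) (rule that)
  have ideal: "closed_ideal (toeplitz_alg \<Omega> \<iota>) (null_space (toeplitz_alg \<Omega> \<iota>) (silov_boundary A) \<Phi>)"
    by (rule null_space_closed_ideal[OF \<Phi>(1,2,4)])
  show ?thesis
  proof (intro exI[of _ \<Phi>] conjI ballI impI)
    fix \<alpha> T
    assume "\<alpha> \<in> silov_boundary A" "p_point A \<alpha>" "T \<in> toeplitz_alg \<Omega> \<iota>"
    then show "(berezin \<Omega> \<iota> T \<longlongrightarrow> op_scaleC (\<Phi> T \<alpha>) id_blinfun) (tends_to_char \<Omega> \<alpha>)"
      by (intro berezin_tendsto \<Phi>(3))
  qed (rule \<Phi>(2) ideal commutator_ideal_subset_null_space[OF \<Phi>(1,2) ideal])+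
qed

end
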